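(* Let $f\in\mathbb{R}[x,y]$ be a polynomial of degree $3$ whose partial derivatives $\frac{\partial f}{\partial x},\frac{\partial f}{\partial y}$ are linearly independent over $\mathbb{R}$, and let $f_3$ be its cubic homogeneous component. Then $f$ is equivalent to a polynomial of exactly one of the following nine types (where $a,b,c,d,e$ denote real parameters subject to the stated restrictions), and for each type the stated equivalence holds: (1) $f\sim ax^3+bx^2+cx-y+d$ ($a\neq0$) if and only if $Z(f)=Z(f_3)\cong T$. (2) $f\sim ax^3+bx^2-y^2+cx+d$ ($a\neq0$) if and only if $\mathbb{R}^2\cong Z(f)\subset Z(f_3)\cong T$. (3) $f\sim ax^3+bx^2-xy+cx+d$ ($a\neq0$) if and only if $\mathbb{R}[\epsilon]/\langle\epsilon^2\rangle\cong Z(f)\subset Z(f_3)\cong T$. (4) $f\sim-xy^2+ax^3+cx-ey+d$ ($a<0$) if and only if $Z(f)=Z(f_3)\cong\mathbb{R}^2$. (5) $f\sim-xy^2+ax^3+bx^2+cx-ey+d$ ($a<0$, $b\neq0$) if and only if $\mathbb{R}\cong Z(f)\subset Z(f_3)\cong\mathbb{R}^2$. (6) $f\sim-xy^2+cx-ey+d$ if and only if $Z(f)=Z(f_3)\cong\mathbb{R}[\epsilon]/\langle\epsilon^2\rangle$. (7) $f\sim-xy^2+bx^2+cx-ey+d$ ($b\neq0$) if and only if $\mathbb{R}\cong Z(f)\subset Z(f_3)\cong\mathbb{R}[\epsilon]/\langle\epsilon^2\rangle$. (8) $f\sim-xy^2+ax^3+cx-ey+d$ ($a>0$) if and only if $Z(f)=Z(f_3)\cong\mathbb{C}$.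 (9) $f\sim-xy^2+ax^3+bx^2+cx-ey+d$ ($a>0$, $b\neq0$) if and only if $\mathbb{R}\cong Z(f)\subset Z(f_3)\cong\mathbb{C}$. In each item, "$f\sim\cdots$" means that $f$ is equivalent to the displayed polynomial for some real values of the parameters satisfying the stated restrictions.
   Context: For a polynomial $f\in\mathbb{R}[x,y]$ with Hessian matrix $H_f$ (the matrix of second partial derivatives), the center of $f$ is $Z(f)=\{X\in\mathbb{R}^{2\times2}\mid(H_fX)^T=H_fX\}$ (equality of matrices with polynomial entries). Two polynomials $f,g\in\mathbb{R}[x,y]$ are equivalent, written $f\sim g$, if there exist $P\in\operatorname{GL}(2,\mathbb{R})$, $v\in\mathbb{R}^2$ and $\lambda\in\mathbb{R}\setminus\{0\}$ such that $g(u)=\lambda f(Pu+v)$, where $u=(x,y)^T$. $T=\left\{\begin{pmatrix} s & 0 \\ r & t \end{pmatrix}\;\middle|\;r,s,t\in\mathbb{R}\right\}$ is the algebra of $2\times2$ real lower-triangular matrices. The symbol $\cong$ denotes isomorphism of $\mathbb{R}$-algebras, centers being equipped with matrix multiplication (under which they are closed in each case listed). *)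

theory Defs
  imports "HOL-Algebra.QuotRing" "HOL-Algebra.Module" "HOL-Analysis.Analysis"
    "HOL-Computational_Algebra.Polynomial"
begin

text \<open>The ring of polynomials in \<open>x\<close> and \<open>y\<close> over the reals is represented as the iterated
  polynomial ring \<^typ>\<open>real poly poly\<close>: the inner variable is \<open>x\<close>, the outer one is \<open>y\<close>. The
  coefficient of \<open>x\<^sup>i y\<^sup>j\<close> in \<open>f\<close> is therefore \<open>coeff (coeff f j) i\<close>.\<close>

definition polyC :: "real \<Rightarrow> real poly poly" where "polyC a = [:[:a:]:]"
definition polyX :: "real poly poly" where "polyX = [:[:0, 1:]:]"
definition polyY :: "real poly poly" where "polyY = [:0, 1:]"

definition total_degree :: "real poly poly \<Rightarrow> nat" where
  "total_degree f = Max (insert 0 {i + j | i j. coeff (coeff f j) i \<noteq> 0})"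

definition hom_component :: "nat \<Rightarrow> real poly poly \<Rightarrow> real poly poly" where
  "hom_component n f =
     (\<Sum>i\<le>n. polyC (coeff (coeff f (n - i)) i) * polyX ^ i * polyY ^ (n - i))"

definition dx :: "real poly poly \<Rightarrow> real poly poly" where "dx f = map_poly pderiv f"
definition dy :: "real poly poly \<Rightarrow> real poly poly" where "dy f = pderiv f"

text \<open>\<open>subst2 f p q\<close> is \<open>f(p, q)\<close>.\<close>

definition subst2 :: "real poly poly \<Rightarrow> real poly poly \<Rightarrow> real poly poly \<Rightarrow> real poly poly" where
  "subst2 f p q = poly (map_poly (\<lambda>c. poly (map_poly polyC c) p) f) q"

definition affine_image :: "real^2^2 \<Rightarrow> real^2 \<Rightarrow> (real poly poly)^2" where
  "affine_image P v = map_matrix polyC P *v vector [polyX, polyY] + (\<chi> i. polyC (v $ i))"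

definition poly_equiv :: "real poly poly \<Rightarrow> real poly poly \<Rightarrow> bool" (infix \<open>\<sim>\<^sub>p\<close> 50) where
  "f \<sim>\<^sub>p g \<longleftrightarrow> (\<exists>(P :: real^2^2) (v :: real^2) (k :: real). invertible P \<and> k \<noteq> 0 \<and>
     g = polyC k * subst2 f (affine_image P v $ 1) (affine_image P v $ 2))"

definition hessian :: "real poly poly \<Rightarrow> (real poly poly)^2^2" where
  "hessian f = vector [vector [dx (dx f), dy (dx f)], vector [dx (dy f), dy (dy f)]]"

definition center :: "real poly poly \<Rightarrow> (real^2^2) set" where
  "center f = {X. transpose (hessian f ** map_matrix polyC X) = hessian f ** map_matrix polyC X}"

definition lower_triangular :: "(real^2^2) set" where
  "lower_triangular = {vector [vector [s, 0], vector [r, t]] | r s t. True}"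

text \<open>Real algebras are records \<^typ>\<open>(real, 'a) module\<close>. The library locale \<open>algebra\<close> covers
  commutative algebras only, whereas the triangular matrices do not commute.\<close>

definition type_algebra :: "(real, 'a :: real_algebra_1) module" where
  "type_algebra = \<lparr>carrier = UNIV, monoid.mult = (*), one = 1, zero = 0, add = (+), module.smult = (*\<^sub>R)\<rparr>"

text \<open>Library multiplication on \<^typ>\<open>real^2\<close> is componentwise, so this is the product algebra.\<close>

abbreviation alg_R :: "(real, real) module" where "alg_R \<equiv> type_algebra"
abbreviation alg_R2 :: "(real, real^2) module" where "alg_R2 \<equiv> type_algebra"
abbreviation alg_C :: "(real, complex) module" where "alg_C \<equiv> type_algebra"

text \<open>A set of matrices with matrix multiplication; it need not be an algebra if the set is
  not closed under the operations.\<close>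

definition matrix_algebra :: "(real^2^2) set \<Rightarrow> (real, real^2^2) module" where
  "matrix_algebra S = \<lparr>carrier = S, monoid.mult = (**), one = mat 1, zero = 0, add = (+), module.smult = (*\<^sub>R)\<rparr>"

definition polynomial_algebra :: "(real, real poly) module" where
  "polynomial_algebra =
     \<lparr>carrier = UNIV, monoid.mult = (*), one = 1, zero = 0, add = (+), module.smult = Polynomial.smult\<rparr>"

definition quotient_algebra :: "(real, 'a) module \<Rightarrow> 'a set \<Rightarrow> (real, 'a set) module" where
  "quotient_algebra A I = ring.extend (A Quot I)
     (module.fields (\<lambda>c K. \<Union>x\<in>K. I +>\<^bsub>A\<^esub> (c \<odot>\<^bsub>A\<^esub> x)))"

definition alg_dual :: "(real, real poly set) module" where
  "alg_dual = quotient_algebra polynomial_algebra (PIdl\<^bsub>polynomial_algebra\<^esub> ([:0, 1:] ^ 2))"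

locale unital_real_algebra = Ring.ring A + Module.module "alg_R" A
  for A :: "(real, 'a) module" (structure) +
  assumes smult_mult_left:
      "\<lbrakk>x \<in> carrier A; y \<in> carrier A\<rbrakk> \<Longrightarrow> (c \<odot> x) \<otimes> y = c \<odot> (x \<otimes> y)"
    and smult_mult_right:
      "\<lbrakk>x \<in> carrier A; y \<in> carrier A\<rbrakk> \<Longrightarrow> x \<otimes> (c \<odot> y) = c \<odot> (x \<otimes> y)"

definition alg_iso :: "(real, 'a) module \<Rightarrow> (real, 'b) module \<Rightarrow> bool" (infix \<open>\<cong>\<^sub>A\<close> 50) where
  "A \<cong>\<^sub>A B \<longleftrightarrow> unital_real_algebra A \<and> unital_real_algebra B \<and>
     (\<exists>h \<in> ring_iso A B. \<forall>c. \<forall>x\<in>carrier A. h (c \<odot>\<^bsub>A\<^esub> x) = c \<odot>\<^bsub>B\<^esub> h x)"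

datatype cubic_type = Type1 | Type2 | Type3 | Type4 | Type5 | Type6 | Type7 | Type8 | Type9

fun normal_forms :: "cubic_type \<Rightarrow> real poly poly set" where
  "normal_forms Type1 = {polyC a * polyX^3 + polyC b * polyX^2 + polyC c * polyX - polyY + polyC d
      | a b c d. a \<noteq> 0}"
| "normal_forms Type2 = {polyC a * polyX^3 + polyC b * polyX^2 - polyY^2 + polyC c * polyX + polyC d
      | a b c d. a \<noteq> 0}"
| "normal_forms Type3 = {polyC a * polyX^3 + polyC b * polyX^2 - polyX * polyY + polyC c * polyX
      + polyC d | a b c d. a \<noteq> 0}"
| "normal_forms Type4 = {- (polyX * polyY^2) + polyC a * polyX^3 + polyC c * polyX - polyC e * polyY
      + polyC d | a c d e. a < 0}"
| "normal_forms Type5 = {- (polyX * polyY^2) + polyC a * polyX^3 + polyC b * polyX^2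
      + polyC c * polyX - polyC e * polyY + polyC d | a b c d e. a < 0 \<and> b \<noteq> 0}"
| "normal_forms Type6 = {- (polyX * polyY^2) + polyC c * polyX - polyC e * polyY + polyC d
      | c d e. True}"
| "normal_forms Type7 = {- (polyX * polyY^2) + polyC b * polyX^2 + polyC c * polyX
      - polyC e * polyY + polyC d | b c d e. b \<noteq> 0}"
| "normal_forms Type8 = {- (polyX * polyY^2) + polyC a * polyX^3 + polyC c * polyX - polyC e * polyY
      + polyC d | a c d e. a > 0}"
| "normal_forms Type9 = {- (polyX * polyY^2) + polyC a * polyX^3 + polyC b * polyX^2
      + polyC c * polyX - polyC e * polyY + polyC d | a b c d e. a > 0 \<and> b \<noteq> 0}"

definition has_type :: "real poly poly \<Rightarrow> cubic_type \<Rightarrow> bool" where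
  "has_type f k \<longleftrightarrow> (\<exists>g \<in> normal_forms k. f \<sim>\<^sub>p g)"

end

theory Submission
  imports Defs
begin

text \<open>If \<open>g(u) = k f(Pu + v)\<close>, then \<open>H\<^sub>g(u) = k P\<^sup>T H\<^sub>f(Pu + v) P\<close>, so
  \<open>Z(f) = P Z(g) P\<^sup>-\<^sup>1\<close>; comparing leading terms along lines gives the same for the cubic components.
  Hence the condition on the centers attached to a type need only be checked on the normal forms, where
  it is a small linear system. The nine conditions exclude one another, because commutativity, nilpotents
  and zero divisors separate the algebras involved. Conversely a real cubic form has a real linear factor, which
  brings \<open>f\<^sub>3\<close> to \<open>ax\<^sup>3\<close> or \<open>ax\<^sup>3 - xy\<^sup>2\<close>, and an affine change of variables then normalizes the
  lower terms; so every \<open>f\<close> has a type, and each center condition forces its type.\<close>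

section \<open>Isomorphisms of real algebras\<close>

text \<open>For a cubic f, symmetry of H_f X is a single off-diagonal equation, affine in x and y:
  two of its coefficients come from f_3, the third from the quadratic part. So Z(f) always lies in
  Z(f_3), and only the quadratic part decides whether the inclusion is proper. For f_3 = ax^3 -
  xy^2, Z(f_3) is R[t]/(t^2 + 3a), so the sign of a selects R^2, the dual numbers or C; a
  translation removes xy and y^2, and a remaining x^2 term cuts the center down to R. For f_3 = ax^3
  nothing in f_3 controls y, so the lower terms in y must decide; independence of the partial
  derivatives prevents y from disappearing. The inclusions compare Z(f) and Z(f_3) as sets, not up
  to isomorphism, so both must be conjugated by the same P. Moreover \<open>\<cong>\<^sub>A\<close>
  requires unital algebras on both sides, while a center is a priori only a set of matrices; the
  axioms are therefore verified on a few explicit models and carried along bijections from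
  there.\<close>

lemma cring_alg_R: "cring alg_R"
proof (intro cringI abelian_groupI comm_monoidI)
  fix x assume "x \<in> carrier alg_R"
  show "\<exists>y\<in>carrier alg_R. y \<oplus>\<^bsub>alg_R\<^esub> x = \<zero>\<^bsub>alg_R\<^esub>"
    by (rule bexI[of _ "- x"]) (simp_all add: type_algebra_def)
qed (simp_all add: type_algebra_def algebra_simps)

text \<open>Negatives are supplied by \<open>(- 1) \<odot> x\<close>, so every premise is a closure
  condition or an equation and none asks for a witness.\<close>

lemma unital_real_algebraI:
  fixes A :: "(real, 'a) module" (structure)
  assumes closed: "\<And>x y. x \<in> carrier A \<Longrightarrow> y \<in> carrier A \<Longrightarrow> x \<oplus> y \<in> carrier A"
      "\<And>x y. x \<in> carrier A \<Longrightarrow> y \<in> carrier A \<Longrightarrow> x \<otimes> y \<in> carrier A"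
      "\<And>c x. x \<in> carrier A \<Longrightarrow> c \<odot> x \<in> carrier A" "\<zero> \<in> carrier A" "\<one> \<in> carrier A"
    and add: "\<And>x y z. x \<in> carrier A \<Longrightarrow> y \<in> carrier A \<Longrightarrow> z \<in> carrier A \<Longrightarrow> (x \<oplus> y) \<oplus> z = x \<oplus> (y \<oplus> z)"
      "\<And>x y. x \<in> carrier A \<Longrightarrow> y \<in> carrier A \<Longrightarrow> x \<oplus> y = y \<oplus> x"
      "\<And>x. x \<in> carrier A \<Longrightarrow> \<zero> \<oplus> x = x"
      "\<And>x. x \<in> carrier A \<Longrightarrow> (- 1) \<odot> x \<oplus> x = \<zero>"
    and mult: "\<And>x y z. x \<in> carrier A \<Longrightarrow> y \<in> carrier A \<Longrightarrow> z \<in> carrier A \<Longrightarrow> (x \<otimes> y) \<otimes> z = x \<otimes> (y \<otimes> z)"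
      "\<And>x. x \<in> carrier A \<Longrightarrow> \<one> \<otimes> x = x" "\<And>x. x \<in> carrier A \<Longrightarrow> x \<otimes> \<one> = x"
      "\<And>x y z. x \<in> carrier A \<Longrightarrow> y \<in> carrier A \<Longrightarrow> z \<in> carrier A \<Longrightarrow> (x \<oplus> y) \<otimes> z = x \<otimes> z \<oplus> y \<otimes> z"
      "\<And>x y z. x \<in> carrier A \<Longrightarrow> y \<in> carrier A \<Longrightarrow> z \<in> carrier A \<Longrightarrow> z \<otimes> (x \<oplus> y) = z \<otimes> x \<oplus> z \<otimes> y"
    and smult: "\<And>c d x. x \<in> carrier A \<Longrightarrow> (c + d) \<odot> x = c \<odot> x \<oplus> d \<odot> x"
      "\<And>c x y. x \<in> carrier A \<Longrightarrow> y \<in> carrier A \<Longrightarrow> c \<odot> (x \<oplus> y) = c \<odot> x \<oplus> c \<odot> y"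
      "\<And>c d x. x \<in> carrier A \<Longrightarrow> (c * d) \<odot> x = c \<odot> (d \<odot> x)"
      "\<And>x. x \<in> carrier A \<Longrightarrow> 1 \<odot> x = x"
      "\<And>c x y. x \<in> carrier A \<Longrightarrow> y \<in> carrier A \<Longrightarrow> (c \<odot> x) \<otimes> y = c \<odot> (x \<otimes> y)"
      "\<And>c x y. x \<in> carrier A \<Longrightarrow> y \<in> carrier A \<Longrightarrow> x \<otimes> (c \<odot> y) = c \<odot> (x \<otimes> y)"
  shows "unital_real_algebra A"
proof -
  have ag: "abelian_group A"
  proof (intro abelian_groupI closed add)
    fix x assume x: "x \<in> carrier A"
    show "\<exists>y\<in>carrier A. y \<oplus> x = \<zero>"
      using add(4)[OF x] closed(3)[OF x] by blast
  qed
  have "ring A"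
    by (intro ringI ag monoidI closed mult)
  moreover have "Module.module alg_R A"
    by (intro Module.moduleI ag cring_alg_R) (use closed smult in \<open>auto simp: type_algebra_def\<close>)
  ultimately show ?thesis
    by (intro unital_real_algebra.intro unital_real_algebra_axioms.intro smult)
qed

lemma unital_real_algebra_minus_add:
  assumes "unital_real_algebra A" "x \<in> carrier A"
  shows "(- 1) \<odot>\<^bsub>A\<^esub> x \<oplus>\<^bsub>A\<^esub> x = \<zero>\<^bsub>A\<^esub>"
proof -
  interpret unital_real_algebra A by fact
  have "((- 1) + 1 :: real) \<odot>\<^bsub>A\<^esub> x = (- 1) \<odot>\<^bsub>A\<^esub> x \<oplus>\<^bsub>A\<^esub> 1 \<odot>\<^bsub>A\<^esub> x"
    using smult_l_distr[of "- 1" 1 x] assms(2) by (simp add: type_algebra_def)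
  then show ?thesis
    using smult_one smult_l_null assms(2) by (simp add: type_algebra_def)
qed

text \<open>The algebra structure on \<open>B\<close> is a conclusion, not an assumption: each axiom
  is pulled back along \<open>h\<close> to \<open>A\<close>. The premises \<open>one\<close> and
  \<open>zero\<close> are there because \<open>B\<close> is not yet known to be a ring.\<close>

lemma alg_iso_transport:
  fixes A :: "(real, 'a) module" and B :: "(real, 'b) module"
  assumes A: "unital_real_algebra A" and bij: "bij_betw h (carrier A) (carrier B)"
    and add: "\<And>x y. x \<in> carrier A \<Longrightarrow> y \<in> carrier A \<Longrightarrow> h (x \<oplus>\<^bsub>A\<^esub> y) = h x \<oplus>\<^bsub>B\<^esub> h y"
    and mult: "\<And>x y. x \<in> carrier A \<Longrightarrow> y \<in> carrier A \<Longrightarrow> h (x \<otimes>\<^bsub>A\<^esub> y) = h x \<otimes>\<^bsub>B\<^esub> h y"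
    and smult: "\<And>c x. x \<in> carrier A \<Longrightarrow> h (c \<odot>\<^bsub>A\<^esub> x) = c \<odot>\<^bsub>B\<^esub> h x"
    and one: "h \<one>\<^bsub>A\<^esub> = \<one>\<^bsub>B\<^esub>" and zero: "h \<zero>\<^bsub>A\<^esub> = \<zero>\<^bsub>B\<^esub>"
  shows "A \<cong>\<^sub>A B"
proof -
  interpret RA: ring A by (rule unital_real_algebra.axioms(1)[OF A])
  interpret A: unital_real_algebra A by fact
  have im: "carrier B = h ` carrier A"
    using bij by (simp add: bij_betw_def)
  note hom = add[symmetric] mult[symmetric] smult[symmetric] one[symmetric] zero[symmetric]
  have R: "c \<in> carrier alg_R" "c \<oplus>\<^bsub>alg_R\<^esub> d = c + d" "c \<otimes>\<^bsub>alg_R\<^esub> d = c * d" "\<one>\<^bsub>alg_R\<^esub> = 1" for c d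
    by (simp_all add: type_algebra_def)
  have [simp]: "c \<odot>\<^bsub>A\<^esub> x \<in> carrier A" if "x \<in> carrier A" for c x
    using A.smult_closed that R by blast
  have sm: "(c + d) \<odot>\<^bsub>A\<^esub> x = c \<odot>\<^bsub>A\<^esub> x \<oplus>\<^bsub>A\<^esub> d \<odot>\<^bsub>A\<^esub> x" "(c * d) \<odot>\<^bsub>A\<^esub> x = c \<odot>\<^bsub>A\<^esub> (d \<odot>\<^bsub>A\<^esub> x)"
     "c \<odot>\<^bsub>A\<^esub> (x \<oplus>\<^bsub>A\<^esub> y) = c \<odot>\<^bsub>A\<^esub> x \<oplus>\<^bsub>A\<^esub> c \<odot>\<^bsub>A\<^esub> y" "1 \<odot>\<^bsub>A\<^esub> x = x"
    if "x \<in> carrier A" "y \<in> carrier A" for c d x y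
    using A.smult_l_distr[of c d x] A.smult_assoc1[of c d x] A.smult_r_distr[of c x y] A.smult_one[of x] that
    by (simp_all add: R)
  have minus: "(- 1) \<odot>\<^bsub>A\<^esub> x \<oplus>\<^bsub>A\<^esub> x = \<zero>\<^bsub>A\<^esub>" "x \<oplus>\<^bsub>A\<^esub> (- 1) \<odot>\<^bsub>A\<^esub> x = \<zero>\<^bsub>A\<^esub>" if "x \<in> carrier A" for x
    using unital_real_algebra_minus_add[OF A that] that by (simp_all add: RA.add.m_comm)
  have "unital_real_algebra B"
    by (rule unital_real_algebraI)
      (auto simp: im hom sm A.smult_mult_left A.smult_mult_right RA.add.m_assoc RA.m_assoc
        RA.l_distr RA.r_distr minus RA.add.m_comm RA.add.m_lcomm)
  moreover have "h \<in> ring_iso A B"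
    using bij by (auto simp: ring_iso_def ring_hom_def add mult one im)
  ultimately show ?thesis
    using A smult by (auto simp: alg_iso_def)
qed

lemma alg_isoE:
  assumes "A \<cong>\<^sub>A B"
  obtains h where "unital_real_algebra A" "unital_real_algebra B" "bij_betw h (carrier A) (carrier B)"
    "\<And>x y. x \<in> carrier A \<Longrightarrow> y \<in> carrier A \<Longrightarrow> h (x \<oplus>\<^bsub>A\<^esub> y) = h x \<oplus>\<^bsub>B\<^esub> h y"
    "\<And>x y. x \<in> carrier A \<Longrightarrow> y \<in> carrier A \<Longrightarrow> h (x \<otimes>\<^bsub>A\<^esub> y) = h x \<otimes>\<^bsub>B\<^esub> h y"
    "\<And>c x. x \<in> carrier A \<Longrightarrow> h (c \<odot>\<^bsub>A\<^esub> x) = c \<odot>\<^bsub>B\<^esub> h x"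
    "h \<one>\<^bsub>A\<^esub> = \<one>\<^bsub>B\<^esub>" "h \<zero>\<^bsub>A\<^esub> = \<zero>\<^bsub>B\<^esub>"
proof -
  obtain h where A: "unital_real_algebra A" and B: "unital_real_algebra B" and h: "h \<in> ring_iso A B"
    "\<forall>c. \<forall>x\<in>carrier A. h (c \<odot>\<^bsub>A\<^esub> x) = c \<odot>\<^bsub>B\<^esub> h x"
    using assms by (auto simp: alg_iso_def)
  have "h \<zero>\<^bsub>A\<^esub> = \<zero>\<^bsub>B\<^esub>"
    using h(1) unital_real_algebra.axioms(1)[OF A] unital_real_algebra.axioms(1)[OF B] by (auto simp: ring_iso_def intro: ring_hom_zero)
  then show thesis
    using that[of h] A B h by (auto simp: ring_iso_def ring_hom_def)
qed

lemma alg_iso_sym: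
  assumes "A \<cong>\<^sub>A B"
  shows "B \<cong>\<^sub>A A"
  using assms
proof (rule alg_isoE)
  fix h
  assume A: "unital_real_algebra A" and B: "unital_real_algebra B" and bij: "bij_betw h (carrier A) (carrier B)"
    and h: "\<And>x y. x \<in> carrier A \<Longrightarrow> y \<in> carrier A \<Longrightarrow> h (x \<oplus>\<^bsub>A\<^esub> y) = h x \<oplus>\<^bsub>B\<^esub> h y"
    "\<And>x y. x \<in> carrier A \<Longrightarrow> y \<in> carrier A \<Longrightarrow> h (x \<otimes>\<^bsub>A\<^esub> y) = h x \<otimes>\<^bsub>B\<^esub> h y"
    "\<And>c x. x \<in> carrier A \<Longrightarrow> h (c \<odot>\<^bsub>A\<^esub> x) = c \<odot>\<^bsub>B\<^esub> h x"
    "h \<one>\<^bsub>A\<^esub> = \<one>\<^bsub>B\<^esub>" "h \<zero>\<^bsub>A\<^esub> = \<zero>\<^bsub>B\<^esub>"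
  interpret A: unital_real_algebra A by fact
  have sm: "c \<odot>\<^bsub>A\<^esub> x \<in> carrier A" if "x \<in> carrier A" for c x
    using A.smult_closed[of c] that by (simp add: type_algebra_def)
  let ?g = "inv_into (carrier A) h"
  have gh: "?g (h x) = x" if "x \<in> carrier A" for x
    using bij_betw_inv_into_left[OF bij that] .
  have im: "carrier B = h ` carrier A"
    using bij by (simp add: bij_betw_def)
  show "B \<cong>\<^sub>A A"
    by (rule alg_iso_transport[OF B bij_betw_inv_into[OF bij]])
      (auto simp: im gh sm h(1-3)[symmetric] h(4,5)[symmetric])
qed

lemma alg_iso_trans [trans]:
  assumes "A \<cong>\<^sub>A B" "B \<cong>\<^sub>A C"
  shows "A \<cong>\<^sub>A C"
  using assms(1)
proof (rule alg_isoE)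
  fix h
  assume A: "unital_real_algebra A" and bij: "bij_betw h (carrier A) (carrier B)"
    and h: "\<And>x y. x \<in> carrier A \<Longrightarrow> y \<in> carrier A \<Longrightarrow> h (x \<oplus>\<^bsub>A\<^esub> y) = h x \<oplus>\<^bsub>B\<^esub> h y"
    "\<And>x y. x \<in> carrier A \<Longrightarrow> y \<in> carrier A \<Longrightarrow> h (x \<otimes>\<^bsub>A\<^esub> y) = h x \<otimes>\<^bsub>B\<^esub> h y"
    "\<And>c x. x \<in> carrier A \<Longrightarrow> h (c \<odot>\<^bsub>A\<^esub> x) = c \<odot>\<^bsub>B\<^esub> h x"
    "h \<one>\<^bsub>A\<^esub> = \<one>\<^bsub>B\<^esub>" "h \<zero>\<^bsub>A\<^esub> = \<zero>\<^bsub>B\<^esub>"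
  have B: "h x \<in> carrier B" if "x \<in> carrier A" for x
    using bij that by (auto simp: bij_betw_def)
  from assms(2) show ?thesis
  proof (rule alg_isoE)
    fix g
    assume g: "bij_betw g (carrier B) (carrier C)"
      "\<And>x y. x \<in> carrier B \<Longrightarrow> y \<in> carrier B \<Longrightarrow> g (x \<oplus>\<^bsub>B\<^esub> y) = g x \<oplus>\<^bsub>C\<^esub> g y"
      "\<And>x y. x \<in> carrier B \<Longrightarrow> y \<in> carrier B \<Longrightarrow> g (x \<otimes>\<^bsub>B\<^esub> y) = g x \<otimes>\<^bsub>C\<^esub> g y"
      "\<And>c x. x \<in> carrier B \<Longrightarrow> g (c \<odot>\<^bsub>B\<^esub> x) = c \<odot>\<^bsub>C\<^esub> g x"
      "g \<one>\<^bsub>B\<^esub> = \<one>\<^bsub>C\<^esub>" "g \<zero>\<^bsub>B\<^esub> = \<zero>\<^bsub>C\<^esub>"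
    show ?thesis
      by (rule alg_iso_transport[OF A bij_betw_trans[OF bij g(1)]]) (simp_all add: h g B)
  qed
qed

section \<open>Invariants that separate the algebras\<close>

definition commutative :: "('a, 'b) ring_scheme \<Rightarrow> bool" where
  "commutative A \<longleftrightarrow> (\<forall>x\<in>carrier A. \<forall>y\<in>carrier A. x \<otimes>\<^bsub>A\<^esub> y = y \<otimes>\<^bsub>A\<^esub> x)"

definition has_nilpotent :: "('a, 'b) ring_scheme \<Rightarrow> bool" where
  "has_nilpotent A \<longleftrightarrow> (\<exists>x\<in>carrier A. x \<noteq> \<zero>\<^bsub>A\<^esub> \<and> x \<otimes>\<^bsub>A\<^esub> x = \<zero>\<^bsub>A\<^esub>)"

definition has_zero_divisors :: "('a, 'b) ring_scheme \<Rightarrow> bool" where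
  "has_zero_divisors A \<longleftrightarrow>
    (\<exists>x\<in>carrier A. \<exists>y\<in>carrier A. x \<noteq> \<zero>\<^bsub>A\<^esub> \<and> y \<noteq> \<zero>\<^bsub>A\<^esub> \<and> x \<otimes>\<^bsub>A\<^esub> y = \<zero>\<^bsub>A\<^esub>)"

lemma alg_iso_invariants:
  assumes "A \<cong>\<^sub>A B"
  shows "commutative A \<longleftrightarrow> commutative B" "has_nilpotent A \<longleftrightarrow> has_nilpotent B"
    "has_zero_divisors A \<longleftrightarrow> has_zero_divisors B"
proof -
  \<comment> \<open>One direction, stated for arbitrary carrier types, is enough: the other is its
    instance at the inverse isomorphism.\<close>
  have "(commutative A \<longrightarrow> commutative B) \<and> (has_nilpotent A \<longrightarrow> has_nilpotent B)
      \<and> (has_zero_divisors A \<longrightarrow> has_zero_divisors B)"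
    if "A \<cong>\<^sub>A B" for A :: "(real, 'x) module" and B :: "(real, 'y) module"
    using that
  proof (rule alg_isoE)
    fix h
    assume bij: "bij_betw h (carrier A) (carrier B)"
      and A: "unital_real_algebra A"
      and mult: "\<And>x y. x \<in> carrier A \<Longrightarrow> y \<in> carrier A \<Longrightarrow> h (x \<otimes>\<^bsub>A\<^esub> y) = h x \<otimes>\<^bsub>B\<^esub> h y"
      and zero: "h \<zero>\<^bsub>A\<^esub> = \<zero>\<^bsub>B\<^esub>"
    interpret A: unital_real_algebra A by fact
    have im: "carrier B = h ` carrier A" and inj: "inj_on h (carrier A)"
      using bij by (simp_all add: bij_betw_def)
    have nz: "h x \<noteq> \<zero>\<^bsub>B\<^esub>" if "x \<in> carrier A" "x \<noteq> \<zero>\<^bsub>A\<^esub>" for x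
      using inj_onD[OF inj, of x "\<zero>\<^bsub>A\<^esub>"] that zero by auto
    have "commutative A \<Longrightarrow> commutative B"
      by (auto simp: commutative_def im mult[symmetric])
    moreover have "has_nilpotent A \<Longrightarrow> has_nilpotent B"
      unfolding has_nilpotent_def im using nz mult zero by (metis imageI)
    moreover have "has_zero_divisors A \<Longrightarrow> has_zero_divisors B"
      unfolding has_zero_divisors_def im using nz mult zero by (metis imageI)
    ultimately show ?thesis by blast
  qed
  note this[OF assms] this[OF alg_iso_sym[OF assms]]
  then show "commutative A \<longleftrightarrow> commutative B" "has_nilpotent A \<longleftrightarrow> has_nilpotent B"
    "has_zero_divisors A \<longleftrightarrow> has_zero_divisors B"
    by blast+
qed

lemma unital_real_algebra_type_algebra:
  "unital_real_algebra (type_algebra :: (real, 'a :: real_algebra_1) module)"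
  by (rule unital_real_algebraI) (auto simp: type_algebra_def algebra_simps)

section \<open>Algebras of two by two matrices\<close>

text \<open>The entry type is general so that real matrices and the Hessian with polynomial entries
  share the same simplification rules.\<close>

definition mat2 :: "'a :: zero \<Rightarrow> 'a \<Rightarrow> 'a \<Rightarrow> 'a \<Rightarrow> 'a^2^2" where
  "mat2 a b c d = vector [vector [a, b], vector [c, d]]"

lemma mat2_nth [simp]:
  "mat2 a b c d $ 1 $ 1 = a" "mat2 a b c d $ 1 $ 2 = b"
  "mat2 a b c d $ 2 $ 1 = c" "mat2 a b c d $ 2 $ 2 = d"
  by (simp_all add: mat2_def)

lemma mat2_eq_iff: "X = Y \<longleftrightarrow> X$1$1 = Y$1$1 \<and> X$1$2 = Y$1$2 \<and> X$2$1 = Y$2$1 \<and> X$2$2 = Y$2$2"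
  for X Y :: "'a^2^2"
  by (auto simp: vec_eq_iff forall_2)

lemma mat2_inject [simp]: "mat2 a b c d = mat2 a' b' c' d' \<longleftrightarrow> a = a' \<and> b = b' \<and> c = c' \<and> d = d'"
  by (simp add: mat2_eq_iff)

lemma mat2_ops [simp]:
  fixes a :: "'a :: comm_ring_1"
  shows "mat2 a b c d + mat2 a' b' c' d' = mat2 (a + a') (b + b') (c + c') (d + d')"
  "mat2 a b c d ** mat2 a' b' c' d' =
     mat2 (a * a' + b * c') (a * b' + b * d') (c * a' + d * c') (c * b' + d * d')"
  "transpose (mat2 a b c d) = mat2 a c b d"
  by (simp_all add: mat2_eq_iff matrix_matrix_mult_def sum_2 transpose_def)

lemma scaleR_mat2 [simp]: "r *\<^sub>R mat2 a b c d = mat2 (r * a) (r * b) (r * c) (r * d)" for r :: real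
  by (simp add: mat2_eq_iff)

lemma mat2_consts: "mat 1 = mat2 1 0 0 (1 :: 'a :: comm_ring_1)" "(0 :: 'a :: comm_ring_1^2^2) = mat2 0 0 0 0"
  by (simp_all add: mat2_eq_iff mat_def)

lemma mat2_cases: obtains a b c d where "(X :: 'a :: zero^2^2) = mat2 a b c d"
proof
  show "X = mat2 (X$1$1) (X$1$2) (X$2$1) (X$2$2)"
    by (simp add: mat2_eq_iff)
qed

lemma matrix_add_rdistrib: "(A + B) ** C = A ** C + B ** C"
  by (vector matrix_matrix_mult_def sum.distrib[symmetric] field_simps)

lemma matrix_inv:
  assumes "invertible P"
  shows "matrix_inv P ** P = mat 1" "P ** matrix_inv P = mat 1"
  using someI_ex[OF assms[unfolded invertible_def]] by (simp_all add: matrix_inv_def)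

text \<open>Zero and negatives come from scaling by 0 and -1.\<close>

definition matrix_subalgebra :: "(real^2^2) set \<Rightarrow> bool" where
  "matrix_subalgebra S \<longleftrightarrow> mat 1 \<in> S \<and> (\<forall>X\<in>S. \<forall>Y\<in>S. X + Y \<in> S \<and> X ** Y \<in> S) \<and> (\<forall>c. \<forall>X\<in>S. c *\<^sub>R X \<in> S)"

lemma matrix_algebra_sel [simp]:
  "carrier (matrix_algebra S) = S" "\<one>\<^bsub>matrix_algebra S\<^esub> = mat 1" "\<zero>\<^bsub>matrix_algebra S\<^esub> = 0"
  "X \<oplus>\<^bsub>matrix_algebra S\<^esub> Y = X + Y" "X \<otimes>\<^bsub>matrix_algebra S\<^esub> Y = X ** Y"
  "c \<odot>\<^bsub>matrix_algebra S\<^esub> X = c *\<^sub>R X"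
  by (simp_all add: matrix_algebra_def)

lemma type_algebra_sel [simp]:
  "carrier type_algebra = UNIV" "\<one>\<^bsub>type_algebra\<^esub> = 1" "\<zero>\<^bsub>type_algebra\<^esub> = 0"
  "x \<oplus>\<^bsub>type_algebra\<^esub> y = x + y" "x \<otimes>\<^bsub>type_algebra\<^esub> y = x * y" "c \<odot>\<^bsub>type_algebra\<^esub> x = c *\<^sub>R x"
  by (simp_all add: type_algebra_def)

lemma unital_real_algebra_matrix_algebra:
  assumes "matrix_subalgebra S"
  shows "unital_real_algebra (matrix_algebra S)"
proof (rule unital_real_algebraI)
  have "0 *\<^sub>R mat 1 \<in> S"
    using assms unfolding matrix_subalgebra_def by blast
  then show "\<zero>\<^bsub>matrix_algebra S\<^esub> \<in> carrier (matrix_algebra S)"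
    by simp
qed (use assms in \<open>auto simp: matrix_subalgebra_def algebra_simps matrix_mul_assoc matrix_add_ldistrib
  matrix_add_rdistrib matrix_scalar_ac scalar_matrix_assoc[symmetric]\<close>)

lemma matrix_algebra_iso_image:
  assumes S: "matrix_subalgebra S" and inj: "inj_on h S"
    and "\<And>X Y. X \<in> S \<Longrightarrow> Y \<in> S \<Longrightarrow> h (X + Y) = h X + h Y"
    and "\<And>X Y. X \<in> S \<Longrightarrow> Y \<in> S \<Longrightarrow> h (X ** Y) = h X ** h Y"
    and sm: "\<And>c X. X \<in> S \<Longrightarrow> h (c *\<^sub>R X) = c *\<^sub>R h X" and "h (mat 1) = mat 1"
  shows "matrix_algebra S \<cong>\<^sub>A matrix_algebra (h ` S)"
proof (rule alg_iso_transport[of _ h])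
  have "h (0 *\<^sub>R mat 1) = 0 *\<^sub>R h (mat 1)"
    using S by (intro sm) (simp add: matrix_subalgebra_def)
  then show "h \<zero>\<^bsub>matrix_algebra S\<^esub> = \<zero>\<^bsub>matrix_algebra (h ` S)\<^esub>"
    by simp
qed (use assms in \<open>auto simp: bij_betw_def unital_real_algebra_matrix_algebra\<close>)

lemma type_algebra_iso_matrix_algebra:
  fixes h :: "'a :: real_algebra_1 \<Rightarrow> real^2^2"
  assumes inj: "inj h" and "\<And>x y. h (x + y) = h x + h y" and "\<And>x y. h (x * y) = h x ** h y"
    and sm: "\<And>c x. h (c *\<^sub>R x) = c *\<^sub>R h x" and "h 1 = mat 1"
  shows "(type_algebra :: (real, 'a) module) \<cong>\<^sub>A matrix_algebra (range h)"
proof (rule alg_iso_transport[of _ h])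
  show "h \<zero>\<^bsub>type_algebra\<^esub> = \<zero>\<^bsub>matrix_algebra (range h)\<^esub>"
    using sm[of 0 0] by simp
qed (use assms in \<open>auto simp: bij_betw_def unital_real_algebra_type_algebra\<close>)

definition conj_by :: "real^2^2 \<Rightarrow> real^2^2 \<Rightarrow> real^2^2" where
  "conj_by P X = P ** X ** matrix_inv P"

lemma conj_by_iso:
  assumes S: "matrix_subalgebra S" and P: "invertible P"
  shows "matrix_algebra S \<cong>\<^sub>A matrix_algebra (conj_by P ` S)"
proof (rule matrix_algebra_iso_image[OF S])
  have inv: "matrix_inv P ** P = mat 1" "P ** matrix_inv P = mat 1"
    using P by (simp_all add: matrix_inv)
  have "matrix_inv P ** conj_by P X ** P = X" for X
    using inv by (simp add: conj_by_def matrix_mul_assoc) (simp add: matrix_mul_assoc[symmetric])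
  then show "inj_on (conj_by P) S"
    by (metis inj_onI)
  show "conj_by P (mat 1) = mat 1"
    using inv by (simp add: conj_by_def)
  show "conj_by P (X ** Y) = conj_by P X ** conj_by P Y" for X Y
  proof -
    have "conj_by P X ** conj_by P Y = P ** X ** (matrix_inv P ** P) ** Y ** matrix_inv P"
      by (simp only: conj_by_def matrix_mul_assoc)
    then show ?thesis
      by (simp add: inv conj_by_def matrix_mul_assoc)
  qed
qed (simp_all add: conj_by_def matrix_add_ldistrib matrix_add_rdistrib matrix_scalar_ac
  scalar_matrix_assoc[symmetric])

section \<open>The matrix algebras that occur as centers of normal forms\<close>

definition scalar_mats :: "(real^2^2) set" where
  "scalar_mats = {mat2 p 0 0 p | p. True}"

definition diagonal_mats :: "(real^2^2) set" where
  "diagonal_mats = {mat2 p 0 0 q | p q. True}"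

definition dual_mats :: "(real^2^2) set" where
  "dual_mats = {mat2 p 0 r p | p r. True}"

text \<open>The matrix with \<open>p = 0\<close>, \<open>q = 1\<close> squares to \<open>m\<close>, so this is \<open>\<real>[t]/(t\<^sup>2 - m)\<close>.\<close>

definition twisted_mats :: "real \<Rightarrow> (real^2^2) set" where
  "twisted_mats m = {mat2 p q (m * q) p | p q. True}"

lemma lower_triangular_mat2: "lower_triangular = {mat2 s 0 r t | r s t. True}"
  by (simp add: lower_triangular_def mat2_def)

lemma matrix_subalgebras:
  "matrix_subalgebra lower_triangular" "matrix_subalgebra scalar_mats" "matrix_subalgebra diagonal_mats"
  "matrix_subalgebra dual_mats" "matrix_subalgebra (twisted_mats m)"
  by (auto simp: matrix_subalgebra_def lower_triangular_mat2 scalar_mats_def diagonal_mats_def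
      dual_mats_def twisted_mats_def mat2_consts algebra_simps)

lemma alg_R_iso_scalar_mats: "alg_R \<cong>\<^sub>A matrix_algebra scalar_mats"
proof -
  define h where "h p = mat2 p 0 0 p" for p :: real
  have "scalar_mats = range h"
    by (auto simp: scalar_mats_def h_def)
  moreover have "alg_R \<cong>\<^sub>A matrix_algebra (range h)"
    by (rule type_algebra_iso_matrix_algebra) (auto simp: h_def inj_def mat2_consts)
  ultimately show ?thesis by simp
qed

lemma alg_R2_iso_diagonal_mats: "alg_R2 \<cong>\<^sub>A matrix_algebra diagonal_mats"
proof -
  define h where "h u = mat2 (u $ 1) 0 0 (u $ 2)" for u :: "real^2"
  have "mat2 p 0 0 q = h (vector [p, q])" for p q
    by (simp add: h_def)
  then have "diagonal_mats \<subseteq> range h"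
    unfolding diagonal_mats_def by blast
  then have "diagonal_mats = range h"
    by (auto simp: diagonal_mats_def h_def)
  moreover have "alg_R2 \<cong>\<^sub>A matrix_algebra (range h)"
    by (rule type_algebra_iso_matrix_algebra) (auto simp: h_def inj_def mat2_consts vec_eq_iff forall_2)
  ultimately show ?thesis by simp
qed

lemma twisted_mats_iso_alg_R2:
  assumes "m > 0"
  shows "matrix_algebra (twisted_mats m) \<cong>\<^sub>A alg_R2"
proof -
  define s where "s = sqrt m"
  have s: "s \<noteq> 0" "m = s * s"
    using assms by (simp_all add: s_def)
  \<comment> \<open>The matrix \<open>mat2 p q (m * q) p\<close> has eigenvalues
    \<open>p + q * s\<close> and \<open>p - q * s\<close>, and it multiplies eigenvalue by
    eigenvalue. The map \<open>h\<close> recovers the matrix from this pair.\<close>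
  define h where "h u = mat2 ((u $ 1 + u $ 2) / 2) ((u $ 1 - u $ 2) / (2 * s))
    (m * ((u $ 1 - u $ 2) / (2 * s))) ((u $ 1 + u $ 2) / 2)" for u :: "real^2"
  have "mat2 p q (m * q) p = h (vector [p + q * s, p - q * s])" for p q
    using s by (simp add: h_def field_simps)
  moreover have "h x \<in> twisted_mats m" for x
    unfolding twisted_mats_def h_def by blast
  ultimately have "twisted_mats m = range h"
    unfolding twisted_mats_def by blast
  moreover have "alg_R2 \<cong>\<^sub>A matrix_algebra (range h)"
  proof (rule type_algebra_iso_matrix_algebra)
    show "inj h"
    proof (rule injI)
      fix u v assume "h u = h v"
      then have "u $ 1 + u $ 2 = v $ 1 + v $ 2" "u $ 1 - u $ 2 = v $ 1 - v $ 2"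
        using s by (simp_all add: h_def)
      then show "u = v" by (simp add: vec_eq_iff forall_2)
    qed
  qed (use s in \<open>auto simp: h_def mat2_consts field_simps\<close>)
  ultimately show ?thesis by (simp add: alg_iso_sym)
qed

lemma twisted_mats_iso_alg_C:
  assumes "m < 0"
  shows "matrix_algebra (twisted_mats m) \<cong>\<^sub>A alg_C"
proof -
  define s where "s = sqrt (- m)"
  have s: "s \<noteq> 0" "m = - (s * s)"
    using assms by (simp_all add: s_def)
  \<comment> \<open>Since \<open>mat2 0 1 m 0\<close> squares to \<open>m = - (s * s)\<close>,
    dividing it by \<open>s\<close> gives a square root of -1, the image of the imaginary
    unit.\<close>
  define h where "h z = mat2 (Re z) (Im z / s) (m * (Im z / s)) (Re z)" for z
  have "mat2 p q (m * q) p = h (Complex p (q * s))" for p q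
    using s by (simp add: h_def)
  moreover have "h x \<in> twisted_mats m" for x
    unfolding twisted_mats_def h_def by blast
  ultimately have "twisted_mats m = range h"
    unfolding twisted_mats_def by blast
  moreover have "alg_C \<cong>\<^sub>A matrix_algebra (range h)"
    by (rule type_algebra_iso_matrix_algebra)
      (use s in \<open>auto simp: h_def inj_def mat2_consts complex_eq_iff field_simps\<close>)
  ultimately show ?thesis by (simp add: alg_iso_sym)
qed

text \<open>Both sets model the dual numbers, one by lower and one by upper triangular matrices.
  Transposition reverses products, but \<open>dual_mats\<close> is commutative, so there it is
  multiplicative.\<close>

lemma twisted_mats_0_iso_dual_mats: "matrix_algebra dual_mats \<cong>\<^sub>A matrix_algebra (twisted_mats 0)"
proof -
  have "transpose ` dual_mats = twisted_mats 0"
    unfolding dual_mats_def twisted_mats_def by (force simp: image_iff)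
  moreover have "matrix_algebra dual_mats \<cong>\<^sub>A matrix_algebra (transpose ` dual_mats)"
    by (rule matrix_algebra_iso_image)
      (use matrix_subalgebras in \<open>auto simp: inj_on_def dual_mats_def mat2_consts\<close>)
  ultimately show ?thesis by simp
qed

section \<open>Dual numbers as a quotient of the polynomial ring\<close>

definition dual_coset :: "real^2^2 \<Rightarrow> real poly set" where
  "dual_coset X = {p. coeff p 0 = X$1$1 \<and> coeff p 1 = X$2$1}"

lemma dual_coset_representative: "[:p, r:] \<in> dual_coset (mat2 p 0 r p)"
  by (simp add: dual_coset_def)

lemma polynomial_algebra_sel [simp]:
  "carrier polynomial_algebra = UNIV" "\<one>\<^bsub>polynomial_algebra\<^esub> = 1" "\<zero>\<^bsub>polynomial_algebra\<^esub> = 0"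
  "x \<oplus>\<^bsub>polynomial_algebra\<^esub> y = x + y" "x \<otimes>\<^bsub>polynomial_algebra\<^esub> y = x * y"
  "c \<odot>\<^bsub>polynomial_algebra\<^esub> x = Polynomial.smult c x"
  by (simp_all add: polynomial_algebra_def)

abbreviation dual_ideal :: "real poly set" where
  "dual_ideal \<equiv> PIdl\<^bsub>polynomial_algebra\<^esub> ([:0, 1:] ^ 2)"

lemma coeff_mult_0_1: "coeff (p * q) (Suc 0) = coeff p 0 * coeff q 1 + coeff p 1 * coeff q 0"
  "coeff (p * q) 0 = coeff p 0 * coeff q 0"
  by (simp_all add: coeff_mult)

lemma dual_ideal_eq: "dual_ideal = {p. coeff p 0 = 0 \<and> coeff p 1 = 0}"
proof -
  have "p \<in> dual_ideal \<longleftrightarrow> [:0, 1:] ^ 2 dvd p" for p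
    by (auto simp: cgenideal_def dvd_def mult.commute)
  also have "[:0, 1:] ^ 2 dvd p \<longleftrightarrow> coeff p 0 = 0 \<and> coeff p 1 = 0" for p :: "real poly"
    using monom_1_dvd_iff'[of 2 p]
    by (auto simp: monom_altdef less_2_cases_iff)
  finally show ?thesis by auto
qed

lemma dual_ideal_coset: "dual_ideal +>\<^bsub>polynomial_algebra\<^esub> p = {q. coeff q 0 = coeff p 0 \<and> coeff q 1 = coeff p 1}"
proof (intro equalityI subsetI)
  fix q assume "q \<in> {q. coeff q 0 = coeff p 0 \<and> coeff q 1 = coeff p 1}"
  then have "q - p \<in> dual_ideal" "q = (q - p) + p"
    by (simp_all add: dual_ideal_eq)
  then show "q \<in> dual_ideal +>\<^bsub>polynomial_algebra\<^esub> p"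
    unfolding a_r_coset_def' by (auto intro!: bexI[of _ "q - p"])
qed (auto simp: a_r_coset_def' dual_ideal_eq)

lemma alg_dual_sel [simp]:
  "carrier alg_dual = range (\<lambda>p. dual_ideal +>\<^bsub>polynomial_algebra\<^esub> p)"
  "\<one>\<^bsub>alg_dual\<^esub> = dual_ideal +>\<^bsub>polynomial_algebra\<^esub> 1" "\<zero>\<^bsub>alg_dual\<^esub> = dual_ideal"
  "K \<oplus>\<^bsub>alg_dual\<^esub> L = K <+>\<^bsub>polynomial_algebra\<^esub> L"
  "K \<otimes>\<^bsub>alg_dual\<^esub> L = rcoset_mult polynomial_algebra dual_ideal K L"
  "c \<odot>\<^bsub>alg_dual\<^esub> K = (\<Union>x\<in>K. dual_ideal +>\<^bsub>polynomial_algebra\<^esub> (Polynomial.smult c x))"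
  by (auto simp: alg_dual_def quotient_algebra_def ring.extend_def module.fields_def FactRing_def A_RCOSETS_def')

text \<open>A coset of the ideal generated by the square of the variable is fixed by the two lowest
  coefficients, which are the first column of the matrix. Transport along this bijection spares a
  verification of the algebra axioms for the quotient.\<close>

lemma dual_coset_iso: "matrix_algebra dual_mats \<cong>\<^sub>A alg_dual"
proof (rule alg_iso_transport[of _ dual_coset])
  show "bij_betw dual_coset (carrier (matrix_algebra dual_mats)) (carrier alg_dual)"
  proof -
    have "inj_on dual_coset dual_mats"
    proof (rule inj_onI)
      fix X Y assume XY: "X \<in> dual_mats" "Y \<in> dual_mats" "dual_coset X = dual_coset Y"
      then obtain p r where X: "X = mat2 p 0 r p" by (auto simp: dual_mats_def)
      then have "[:p, r:] \<in> dual_coset Y" using dual_coset_representative XY by blast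
      then show "X = Y" using XY X by (auto simp: dual_coset_def dual_mats_def)
    qed
    moreover have "dual_coset ` dual_mats = range (\<lambda>p. dual_ideal +>\<^bsub>polynomial_algebra\<^esub> p)"
    proof (intro equalityI subsetI)
      fix K assume "K \<in> dual_coset ` dual_mats"
      then obtain p r where "K = dual_coset (mat2 p 0 r p)" by (auto simp: dual_mats_def)
      then have "K = dual_ideal +>\<^bsub>polynomial_algebra\<^esub> [:p, r:]"
        by (simp add: dual_coset_def dual_ideal_coset)
      then show "K \<in> range (\<lambda>p. dual_ideal +>\<^bsub>polynomial_algebra\<^esub> p)" by blast
    next
      fix K assume "K \<in> range (\<lambda>p. dual_ideal +>\<^bsub>polynomial_algebra\<^esub> p)"
      then obtain p where "K = dual_coset (mat2 (coeff p 0) 0 (coeff p 1) (coeff p 0))"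
        by (auto simp: dual_coset_def dual_ideal_coset)
      then show "K \<in> dual_coset ` dual_mats" by (auto simp: dual_mats_def)
    qed
    ultimately show ?thesis by (simp add: bij_betw_def)
  qed
  fix X Y assume "X \<in> carrier (matrix_algebra dual_mats)" "Y \<in> carrier (matrix_algebra dual_mats)"
  then obtain p r p' r' where X: "X = mat2 p 0 r p" and Y: "Y = mat2 p' 0 r' p'"
    by (auto simp: dual_mats_def)
  show "dual_coset (X \<oplus>\<^bsub>matrix_algebra dual_mats\<^esub> Y) = dual_coset X \<oplus>\<^bsub>alg_dual\<^esub> dual_coset Y"
  proof (intro equalityI subsetI)
    fix q assume "q \<in> dual_coset (X \<oplus>\<^bsub>matrix_algebra dual_mats\<^esub> Y)"
    then have "q - [:p', r':] \<in> dual_coset X" "[:p', r':] \<in> dual_coset Y"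
      by (auto simp: dual_coset_def X Y)
    then show "q \<in> dual_coset X \<oplus>\<^bsub>alg_dual\<^esub> dual_coset Y"
      by (force simp: set_add_def')
  qed (auto simp: dual_coset_def X Y set_add_def')
  \<comment> \<open>The quotient product is a union over all pairs of representatives. Every member
    of the union is the same coset, so it collapses once both index sets are known to be nonempty,
    which \<open>dual_coset_representative\<close> shows. Scalar multiples are treated in the same
    way below.\<close>
  have "dual_coset X \<otimes>\<^bsub>alg_dual\<^esub> dual_coset Y
    = (\<Union>a\<in>dual_coset X. \<Union>b\<in>dual_coset Y. dual_coset (X ** Y))"
    unfolding alg_dual_sel rcoset_mult_def dual_ideal_coset
    by (intro SUP_cong refl) (auto simp: dual_coset_def X Y coeff_mult_0_1)
  then show "dual_coset (X \<otimes>\<^bsub>matrix_algebra dual_mats\<^esub> Y) = dual_coset X \<otimes>\<^bsub>alg_dual\<^esub> dual_coset Y"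
    using dual_coset_representative[of p r] dual_coset_representative[of p' r'] X Y by auto
next
  fix c X assume "X \<in> carrier (matrix_algebra dual_mats)"
  then obtain p r where X: "X = mat2 p 0 r p" by (auto simp: dual_mats_def)
  have "c \<odot>\<^bsub>alg_dual\<^esub> dual_coset X = (\<Union>x\<in>dual_coset X. dual_coset (c *\<^sub>R X))"
    unfolding alg_dual_sel dual_ideal_coset by (intro SUP_cong refl) (auto simp: dual_coset_def X)
  then show "dual_coset (c \<odot>\<^bsub>matrix_algebra dual_mats\<^esub> X) = c \<odot>\<^bsub>alg_dual\<^esub> dual_coset X"
    using dual_coset_representative[of p r] X by auto
next
  show "dual_coset \<one>\<^bsub>matrix_algebra dual_mats\<^esub> = \<one>\<^bsub>alg_dual\<^esub>"
    unfolding alg_dual_sel dual_ideal_coset by (simp add: dual_coset_def mat2_consts)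
  show "dual_coset \<zero>\<^bsub>matrix_algebra dual_mats\<^esub> = \<zero>\<^bsub>alg_dual\<^esub>"
    unfolding alg_dual_sel dual_ideal_eq by (simp add: dual_coset_def mat2_consts)
qed (simp add: matrix_subalgebras unital_real_algebra_matrix_algebra)

section \<open>The invariants of the model algebras\<close>

lemma commutative_type_algebra: "commutative (type_algebra :: (real, 'a :: {real_algebra_1, comm_ring_1}) module)"
  by (simp add: commutative_def mult.commute)

lemma invariants_alg_dual: "commutative alg_dual" "has_nilpotent alg_dual"
proof -
  have "commutative (matrix_algebra dual_mats)" "has_nilpotent (matrix_algebra dual_mats)"
    by (auto simp: commutative_def has_nilpotent_def dual_mats_def mat2_consts intro: exI[of _ "mat2 0 0 1 0"])
  then show "commutative alg_dual" "has_nilpotent alg_dual"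
    using alg_iso_invariants[OF dual_coset_iso] by auto
qed

lemma invariants_alg_C: "\<not> has_nilpotent alg_C" "\<not> has_zero_divisors alg_C"
  by (auto simp: has_nilpotent_def has_zero_divisors_def)

lemma invariants_alg_R2: "\<not> has_nilpotent alg_R2" "has_zero_divisors alg_R2"
proof -
  show "\<not> has_nilpotent alg_R2"
    by (auto simp: has_nilpotent_def vec_eq_iff)
  have "vector [1, 0] * vector [0, 1] = (0 :: real^2)" "vector [1, 0] \<noteq> (0 :: real^2)" "vector [0, 1] \<noteq> (0 :: real^2)"
    by (auto simp: vec_eq_iff forall_2)
  then show "has_zero_divisors alg_R2"
    unfolding has_zero_divisors_def by auto
qed

lemma not_commutative_lower_triangular: "\<not> commutative (matrix_algebra lower_triangular)"
proof
  have "mat2 1 0 0 0 \<in> lower_triangular" "mat2 0 0 1 0 \<in> lower_triangular"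
    by (auto simp: lower_triangular_mat2)
  moreover assume "commutative (matrix_algebra lower_triangular)"
  ultimately have "mat2 1 0 0 0 ** mat2 0 0 1 0 = (mat2 0 0 1 0 ** mat2 1 0 0 0 :: real^2^2)"
    unfolding commutative_def matrix_algebra_sel by blast
  then show False by simp
qed

section \<open>Polynomials as functions and the chain rule\<close>

definition eval2 :: "real poly poly \<Rightarrow> real \<Rightarrow> real \<Rightarrow> real" where
  "eval2 f x y = poly (poly f [:y:]) x"

lemma eval2_simps [simp]:
  "eval2 (polyC a) x y = a" "eval2 polyX x y = x" "eval2 polyY x y = y"
  "eval2 0 x y = 0" "eval2 1 x y = 1"
  "eval2 (f + g) x y = eval2 f x y + eval2 g x y" "eval2 (f - g) x y = eval2 f x y - eval2 g x y"
  "eval2 (- f) x y = - eval2 f x y"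
  "eval2 (f * g) x y = eval2 f x y * eval2 g x y" "eval2 (f ^ n) x y = eval2 f x y ^ n"
  by (simp_all add: eval2_def polyC_def polyX_def polyY_def)

lemma eval2_numeral [simp]: "eval2 (numeral n) x y = numeral n"
  by (simp add: eval2_def)

lemma eval2_pCons: "eval2 (pCons c f) x y = poly c x + y * eval2 f x y"
  by (simp add: eval2_def)

lemma eval2_eqI:
  assumes "\<And>x y. eval2 f x y = eval2 g x y"
  shows "f = g"
proof -
  have "h = 0" if "\<And>x y. eval2 h x y = 0" for h
    using that
  proof (induction h)
    case (pCons c h)
    have *: "poly c x + y * eval2 h x y = 0" for x y
      using pCons.prems[of x y] by (simp add: eval2_pCons)
    have "poly c x = 0" for x
      using *[of x 0] by simp
    then have c: "c = 0"
      using poly_all_0_iff_0 by blast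
    have "poly (map_poly (\<lambda>p. poly p x) h) y = eval2 h x y" for x y
      by (induction h) (simp_all add: eval2_def map_poly_pCons)
    \<comment> \<open>Cancelling \<open>y\<close> pointwise would fail at y = 0. For fixed
      \<open>x\<close> the product is instead a polynomial in \<open>y\<close> that vanishes
      identically, so its tail is the zero polynomial.\<close>
    then have "poly (pCons 0 (map_poly (\<lambda>p. poly p x) h)) y = 0" for x y
      using *[of x y] c by simp
    then have "map_poly (\<lambda>p. poly p x) h = 0" for x
      using poly_all_0_iff_0 by (metis pCons_eq_0_iff)
    then have "eval2 h x y = 0" for x y
      using \<open>\<And>x y. poly (map_poly (\<lambda>p. poly p x) h) y = eval2 h x y\<close>[of x y] by simp
    then show ?case
      using pCons.IH c by simp
  qed simp
  from this[of "f - g"] show ?thesis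
    using assms by simp
qed

lemma map_poly_polyC_pCons: "map_poly polyC (pCons a c) = pCons (polyC a) (map_poly polyC c)"
  by (simp add: map_poly_pCons polyC_def)

lemma eval2_poly_polyC: "eval2 (poly (map_poly polyC c) p) x y = poly c (eval2 p x y)"
  by (induction c) (simp_all add: map_poly_polyC_pCons)

lemma eval2_subst2: "eval2 (subst2 f p q) x y = eval2 f (eval2 p x y) (eval2 q x y)"
proof (induction f)
  case (pCons c f)
  then show ?case
    by (simp add: subst2_def map_poly_pCons eval2_pCons eval2_poly_polyC)
qed (simp add: subst2_def)

lemma affine_image_nth:
  "affine_image P v $ i = polyC (P$i$1) * polyX + polyC (P$i$2) * polyY + polyC (v$i)"
  by (simp add: affine_image_def matrix_vector_mult_def sum_2 map_matrix_def)

text \<open>The witnesses stay visible because one \<open>P\<close> must conjugate both Z(f) and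
  Z(f_3). With real functions in place of polynomials, an equivalence is checked by
  arithmetic.\<close>

definition fun_equiv_by :: "real^2^2 \<Rightarrow> real^2 \<Rightarrow> real \<Rightarrow> (real \<Rightarrow> real \<Rightarrow> real) \<Rightarrow> (real \<Rightarrow> real \<Rightarrow> real) \<Rightarrow> bool" where
  "fun_equiv_by P v k F G \<longleftrightarrow> invertible P \<and> k \<noteq> 0 \<and>
    (\<forall>x y. G x y = k * F (P$1$1 * x + P$1$2 * y + v$1) (P$2$1 * x + P$2$2 * y + v$2))"

lemma poly_equiv_iff: "f \<sim>\<^sub>p g \<longleftrightarrow> (\<exists>P v k. fun_equiv_by P v k (eval2 f) (eval2 g))"
proof -
  have "g = polyC k * subst2 f (affine_image P v $ 1) (affine_image P v $ 2) \<longleftrightarrow>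
    (\<forall>x y. eval2 g x y = k * eval2 f (P$1$1 * x + P$1$2 * y + v$1) (P$2$1 * x + P$2$2 * y + v$2))" for P v k
    by (auto simp: eval2_subst2 affine_image_nth intro!: eval2_eqI)
  then show ?thesis
    by (simp add: poly_equiv_def fun_equiv_by_def)
qed

section \<open>Partial derivatives and the chain rule\<close>

lemma dx_pCons: "dx (pCons c f) = pCons (pderiv c) (dx f)"
  by (simp add: dx_def map_poly_pCons)

lemma dx_0 [simp]: "dx 0 = 0" and dy_0 [simp]: "dy 0 = 0"
  by (simp_all add: dx_def dy_def)

lemma dx_add [simp]: "dx (f + g) = dx f + dx g"
  by (rule poly_eqI) (simp add: dx_def coeff_map_poly pderiv_add)

text \<open>The scalar \<open>c\<close> is itself a polynomial in x, so scalar multiplication obeys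
  a product rule.\<close>

lemma dx_smult: "dx (Polynomial.smult c f) = Polynomial.smult (pderiv c) f + Polynomial.smult c (dx f)"
  by (rule poly_eqI) (simp add: dx_def coeff_map_poly pderiv_mult algebra_simps)

lemma dx_mult [simp]: "dx (f * g) = dx f * g + f * dx g"
  by (induction f) (simp_all add: dx_pCons dx_smult algebra_simps)

lemma dy_add [simp]: "dy (f + g) = dy f + dy g" and dy_mult [simp]: "dy (f * g) = dy f * g + f * dy g"
  by (simp_all add: dy_def pderiv_add pderiv_mult algebra_simps)

lemma dx_dy_gens [simp]:
  "dx (polyC a) = 0" "dx polyX = 1" "dx polyY = 0" "dy (polyC a) = 0" "dy polyX = 0" "dy polyY = 1"
  "dx 1 = 0" "dy 1 = 0"
  by (simp_all add: dx_def dy_def polyC_def polyX_def polyY_def map_poly_pCons pderiv_pCons one_pCons)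

lemma dx_dy_numeral [simp]: "dx (numeral n) = 0" "dy (numeral n) = 0"
proof -
  have "numeral n = polyC (numeral n)"
    by (rule eval2_eqI) simp
  then show "dx (numeral n) = 0" "dy (numeral n) = 0"
    by (metis dx_dy_gens(1), metis dx_dy_gens(4))
qed

lemma dy_pCons: "dy (pCons c f) = f + polyY * dy f"
  by (simp add: dy_def polyY_def pderiv_pCons)

lemma dx_dy_commute: "dx (dy f) = dy (dx f)"
  by (induction f) (simp_all add: dy_pCons dx_pCons)

lemma subst2_pCons: "subst2 (pCons c f) p q = poly (map_poly polyC c) p + q * subst2 f p q"
  by (simp add: subst2_def map_poly_pCons)

lemma subst2_0 [simp]: "subst2 0 p q = 0"
  by (simp add: subst2_def)

lemma subst2_add: "subst2 (f + g) p q = subst2 f p q + subst2 g p q"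
  and subst2_mult: "subst2 (f * g) p q = subst2 f p q * subst2 g p q"
  by (rule eval2_eqI; simp add: eval2_subst2)+

lemma chain_rule:
  "dx (subst2 f p q) = dx p * subst2 (dx f) p q + dx q * subst2 (dy f) p q"
  "dy (subst2 f p q) = dy p * subst2 (dx f) p q + dy q * subst2 (dy f) p q"
proof (induction f)
  case (pCons c f)
  let ?C = "\<lambda>c. poly (map_poly polyC c) p"
  \<comment> \<open>The outer induction on powers of y leaves the coefficient \<open>c\<close>, a
    polynomial in x alone, evaluated at \<open>p\<close>; an inner induction differentiates
    it.\<close>
  have C: "dx (?C c) = dx p * ?C (pderiv c) \<and> dy (?C c) = dy p * ?C (pderiv c)"
  proof (induction c)
    case (pCons a c)
    have "?C (a + b) = ?C a + ?C b" for a b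
      by (rule eval2_eqI) (simp add: eval2_poly_polyC)
    moreover have "polyC 0 = 0"
      by (simp add: polyC_def)
    ultimately show ?case
      using pCons by (simp add: map_poly_polyC_pCons pderiv_pCons algebra_simps)
  qed simp
  have Y: "subst2 polyY p q = q"
    by (rule eval2_eqI) (simp add: eval2_subst2)
  show "dx (subst2 (pCons c f) p q) = dx p * subst2 (dx (pCons c f)) p q + dx q * subst2 (dy (pCons c f)) p q"
    "dy (subst2 (pCons c f) p q) = dy p * subst2 (dx (pCons c f)) p q + dy q * subst2 (dy (pCons c f)) p q"
    using pCons.IH C by (simp_all add: subst2_pCons dx_pCons dy_pCons subst2_add subst2_mult Y algebra_simps)
qed simp_all

section \<open>Centers under affine substitutions\<close>

text \<open>Using the same mixed partial twice builds in the symmetry of the Hessian; evaluation at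
  a point leaves only real matrices to handle.\<close>

definition hess_at :: "real poly poly \<Rightarrow> real \<Rightarrow> real \<Rightarrow> real^2^2" where
  "hess_at f x y = mat2 (eval2 (dx (dx f)) x y) (eval2 (dx (dy f)) x y)
     (eval2 (dx (dy f)) x y) (eval2 (dy (dy f)) x y)"

lemma center_iff_hess_at:
  "X \<in> center f \<longleftrightarrow> (\<forall>x y. transpose (hess_at f x y ** X) = hess_at f x y ** X)"
proof -
  obtain p q r s where X: "X = mat2 p q r s"
    by (rule mat2_cases)
  have "map_matrix polyC X = mat2 (polyC p) (polyC q) (polyC r) (polyC s)"
    by (simp add: mat2_eq_iff map_matrix_def X)
  moreover have "hessian f = mat2 (dx (dx f)) (dx (dy f)) (dx (dy f)) (dy (dy f))"
    by (simp add: hessian_def mat2_def dx_dy_commute)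
  ultimately have "X \<in> center f \<longleftrightarrow> dx (dx f) * polyC q + dx (dy f) * polyC s
      = dx (dy f) * polyC p + dy (dy f) * polyC r" (is "_ \<longleftrightarrow> ?L = ?R")
    by (auto simp: center_def)
  also have "\<dots> \<longleftrightarrow> (\<forall>x y. eval2 ?L x y = eval2 ?R x y)"
    by (metis eval2_eqI)
  also have "\<dots> \<longleftrightarrow> (\<forall>x y. transpose (hess_at f x y ** X) = hess_at f x y ** X)"
    unfolding hess_at_def X mat2_ops mat2_inject eval2_simps by metis
  finally show ?thesis .
qed

lemma fun_equiv_byD:
  assumes "fun_equiv_by P v k (eval2 f) (eval2 g)"
  shows "invertible P" "k \<noteq> 0" "g = polyC k * subst2 f (affine_image P v $ 1) (affine_image P v $ 2)"
  using assms by (auto simp: fun_equiv_by_def eval2_subst2 affine_image_nth intro!: eval2_eqI)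

lemma fun_equiv_by_hess_at:
  assumes "fun_equiv_by P v k (eval2 f) (eval2 g)"
  shows "hess_at g x y = k *\<^sub>R (transpose P **
    hess_at f (P$1$1 * x + P$1$2 * y + v$1) (P$2$1 * x + P$2$2 * y + v$2) ** P)"
proof -
  obtain p q r s where P: "P = mat2 p q r s"
    by (rule mat2_cases)
  show ?thesis
    by (simp add: fun_equiv_byD(3)[OF assms] hess_at_def chain_rule affine_image_nth eval2_subst2 P
      dx_dy_commute[of f, symmetric] algebra_simps)
qed

lemma affine_map_surj:
  fixes P :: "real^2^2" and v :: "real^2"
  assumes "invertible P"
  obtains x y where "P$1$1 * x + P$1$2 * y + v$1 = (a :: real)" "P$2$1 * x + P$2$2 * y + v$2 = b"
proof -
  obtain u where "P *v u = vector [a - v$1, b - v$2]"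
    using assms by (metis matrix_inv(2) matrix_vector_mul_assoc matrix_vector_mul_lid)
  then have "P$1$1 * u$1 + P$1$2 * u$2 = a - v$1" "P$2$1 * u$1 + P$2$2 * u$2 = b - v$2"
    by (simp_all add: vec_eq_iff forall_2 matrix_vector_mult_def sum_2)
  then show thesis
    using that[of "u$1" "u$2"] by simp
qed

lemma conj_by_cancel:
  assumes "invertible P"
  shows "P ** X = conj_by P X ** P"
  using matrix_inv[OF assms] by (simp add: conj_by_def matrix_mul_assoc[symmetric])

text \<open>Since \<open>P ** X = conj_by P X ** P\<close>, the matrix H_g X is, up to the factor
  \<open>k\<close>, the congruence by \<open>P\<close> of H_f times \<open>conj_by P X\<close>. The
  map sending M to P^T M P preserves symmetry and, being injective, reflects it. Surjectivity of the
  affine map turns all points for \<open>g\<close> into all points for \<open>f\<close>.\<close>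

lemma center_conj_by:
  assumes "fun_equiv_by P v k (eval2 f) (eval2 g)"
  shows "center f = conj_by P ` center g"
proof -
  note P = fun_equiv_byD(1,2)[OF assms]
  have cancel: "transpose P ** M ** P = transpose P ** N ** P \<longleftrightarrow> M = N" for M N
  proof
    let ?Q = "matrix_inv P"
    assume "transpose P ** M ** P = transpose P ** N ** P"
    then have "transpose ?Q ** (transpose P ** M ** P) ** ?Q = transpose ?Q ** (transpose P ** N ** P) ** ?Q"
      by simp
    moreover have "transpose ?Q ** transpose P = mat 1"
      using matrix_inv[OF P(1)] by (simp flip: matrix_transpose_mul)
    ultimately show "M = N"
      using matrix_inv[OF P(1)] by (simp add: matrix_mul_assoc) (simp add: matrix_mul_assoc[symmetric])
  qed simp
  have "X \<in> center g \<longleftrightarrow> conj_by P X \<in> center f" for X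
  proof -
    have "transpose (hess_at g x y ** X) = hess_at g x y ** X \<longleftrightarrow>
      transpose (hess_at f x' y' ** conj_by P X) = hess_at f x' y' ** conj_by P X"
      if "x' = P$1$1 * x + P$1$2 * y + v$1" "y' = P$2$1 * x + P$2$2 * y + v$2" for x y x' y'
    proof -
      let ?M = "hess_at f x' y' ** conj_by P X"
      have "hess_at g x y ** X = k *\<^sub>R (transpose P ** ?M ** P)"
        using fun_equiv_by_hess_at[OF assms, of x y] that
        by (simp add: conj_by_cancel[OF P(1)] matrix_mul_assoc[symmetric] scalar_matrix_assoc[symmetric])
      moreover have "transpose (transpose P ** ?M ** P) = transpose P ** transpose ?M ** P"
        by (simp add: matrix_transpose_mul matrix_mul_assoc)
      ultimately show ?thesis
        using P(2) by (simp add: transpose_scalar cancel)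
    qed
    then show ?thesis
      unfolding center_iff_hess_at using affine_map_surj[OF P(1), of v] by metis
  qed
  moreover have "conj_by P (matrix_inv P ** Y ** P) = Y" for Y
    using matrix_inv[OF P(1)] by (simp add: conj_by_def matrix_mul_assoc) (simp add: matrix_mul_assoc[symmetric])
  ultimately show ?thesis
    by (metis image_iff subsetI subset_antisym)
qed

section \<open>Cubic polynomials by their ten coefficients\<close>

definition cubic_poly :: "real \<Rightarrow> real \<Rightarrow> real \<Rightarrow> real \<Rightarrow> real \<Rightarrow> real \<Rightarrow> real \<Rightarrow> real \<Rightarrow> real \<Rightarrow> real \<Rightarrow> real poly poly" where
  "cubic_poly a b c d e f g h i j =
     polyC a * polyX^3 + polyC b * polyX^2 * polyY + polyC c * polyX * polyY^2 + polyC d * polyY^3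
     + polyC e * polyX^2 + polyC f * polyX * polyY + polyC g * polyY^2
     + polyC h * polyX + polyC i * polyY + polyC j"

lemma eval2_cubic_poly [simp]:
  "eval2 (cubic_poly a b c d e f g h i j) x y =
     a * x^3 + b * x^2 * y + c * x * y^2 + d * y^3 + e * x^2 + f * x * y + g * y^2 + h * x + i * y + j"
  by (simp add: cubic_poly_def)

lemma monom_eq_polyX_polyY: "polyC a * polyX ^ m * polyY ^ n = monom (monom a m) n"
proof -
  have "polyC a * polyX ^ m = [:monom a m:]"
    by (induction m) (simp_all add: polyC_def polyX_def monom_0 monom_Suc mult.left_commute[of "[:[:a:]:]"])
  moreover have "polyY ^ n = monom 1 n"
    by (simp add: polyY_def monom_altdef)
  ultimately show ?thesis
    by (simp add: smult_monom)
qed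

text \<open>In this form simplification can read off coefficients, through which
  \<open>hom_component\<close> and \<open>total_degree\<close> are defined.\<close>

lemma cubic_poly_monoms:
  "cubic_poly a b c d e f g h i j =
     monom (monom a 3) 0 + monom (monom b 2) 1 + monom (monom c 1) 2 + monom (monom d 0) 3
     + monom (monom e 2) 0 + monom (monom f 1) 1 + monom (monom g 0) 2
     + monom (monom h 1) 0 + monom (monom i 0) 1 + monom (monom j 0) 0"
  unfolding monom_eq_polyX_polyY[symmetric] cubic_poly_def by simp

lemma hom_component_cubic_poly:
  "hom_component 3 (cubic_poly a b c d e f g h i j) = cubic_poly a b c d 0 0 0 0 0 0"
proof -
  have "{..3::nat} = {0, 1, 2, 3}" by auto
  then show ?thesis
    by (intro eval2_eqI) (simp add: hom_component_def cubic_poly_monoms[of a b c d e f g h i j])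
qed

lemma cubic_polyE:
  assumes "total_degree f \<le> 3"
  obtains a b c d e k l m n p where "f = cubic_poly a b c d e k l m n p"
proof -
  \<comment> \<open>\<open>Max\<close> is known to be an upper bound only for a finite set.\<close>
  have fin: "finite {i + j | i j. coeff (coeff f j) i \<noteq> 0}"
  proof (rule finite_subset)
    show "{i + j | i j. coeff (coeff f j) i \<noteq> 0}
      \<subseteq> (\<Union>j\<le>degree f. (\<lambda>i. i + j) ` {..degree (coeff f j)})"
    proof
      fix n assume "n \<in> {i + j | i j. coeff (coeff f j) i \<noteq> 0}"
      then obtain i j where "n = i + j" "coeff (coeff f j) i \<noteq> 0" by blast
      moreover from this have "coeff f j \<noteq> 0" by auto
      ultimately show "n \<in> (\<Union>j\<le>degree f. (\<lambda>i. i + j) ` {..degree (coeff f j)})"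
        by (auto intro!: bexI[of _ j] imageI le_degree)
    qed
  qed simp
  have 0: "coeff (coeff f j) i = 0" if "i + j > 3" for i j
  proof (rule ccontr)
    assume "coeff (coeff f j) i \<noteq> 0"
    then have "i + j \<le> total_degree f"
      unfolding total_degree_def using fin by (intro Max_ge) auto
    then show False using that assms by simp
  qed
  let ?c = "\<lambda>i j. coeff (coeff f j) i"
  have "f = cubic_poly (?c 3 0) (?c 2 1) (?c 1 2) (?c 0 3) (?c 2 0) (?c 1 1) (?c 0 2) (?c 1 0) (?c 0 1) (?c 0 0)"
  proof (intro poly_eqI)
    fix i j :: nat
    show "coeff (coeff f j) i = coeff (coeff (cubic_poly (?c 3 0) (?c 2 1) (?c 1 2) (?c 0 3) (?c 2 0) (?c 1 1)
      (?c 0 2) (?c 1 0) (?c 0 1) (?c 0 0)) j) i"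
    proof (cases "i + j > 3")
      case True
      then show ?thesis
        by (simp only: 0 cubic_poly_monoms coeff_add coeff_monom) (auto simp: coeff_monom)
    next
      case False
      then have "i = 0 \<or> i = 1 \<or> i = 2 \<or> i = 3" "j = 0 \<or> j = 1 \<or> j = 2 \<or> j = 3"
        by linarith+
      then show ?thesis
        using False by (elim disjE; simp add: cubic_poly_monoms)
    qed
  qed
  then show thesis by (rule that)
qed

text \<open>Four distinct zeros are too many for a nonzero polynomial of degree at most 3.\<close>

lemma poly3_lead_zero:
  fixes a b c d :: real
  assumes "\<And>t. a * t^3 + b * t^2 + c * t + d = 0"
  shows "a = 0"
  using assms[of 0] assms[of 1] assms[of "- 1"] assms[of 2] by simp

text \<open>On the line through the origin and (x, y), with parameter t, the translation
  \<open>v\<close> contributes only to powers of t below the third. The coefficients of t^3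
  therefore satisfy the same relation with \<open>v\<close> replaced by 0 and with \<open>P\<close>
  and \<open>k\<close> unchanged.\<close>

lemma fun_equiv_by_hom_component:
  assumes "fun_equiv_by P v k (eval2 (cubic_poly a b c d e f g h i j)) (eval2 (cubic_poly a' b' c' d' e' f' g' h' i' j'))"
  shows "fun_equiv_by P 0 k (eval2 (cubic_poly a b c d 0 0 0 0 0 0)) (eval2 (cubic_poly a' b' c' d' 0 0 0 0 0 0))"
  unfolding fun_equiv_by_def
proof (intro conjI allI)
  fix x y
  define X Y where "X = P$1$1 * x + P$1$2 * y" "Y = P$2$1 * x + P$2$2 * y"
  let ?F = "\<lambda>x y. a * x^3 + b * x^2 * y + c * x * y^2 + d * y^3"
  let ?G = "\<lambda>x y. a' * x^3 + b' * x^2 * y + c' * x * y^2 + d' * y^3"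
  define u w where "u = v$1" "w = v$2"
  \<comment> \<open>Stated for arbitrary coefficients, so that the long expressions
    \<open>?q\<close>, \<open>?l\<close> and \<open>?c\<close> need not be expanded when terms are
    collected.\<close>
  have collect: "(A - k * A') * t^3 + (B - k * B') * t^2 + (C - k * C') * t + (D - k * D') = 0"
    if "A * t^3 + B * t^2 + C * t + D = k * (A' * t^3 + B' * t^2 + C' * t + D')" for t A A' B B' C C' D D' :: real
    using that by (simp add: algebra_simps)
  have "?G x y - k * ?F X Y = 0"
  proof (rule poly3_lead_zero)
    fix t
    have "P$1$1 * (t * x) + P$1$2 * (t * y) + v$1 = t * X + u" "P$2$1 * (t * x) + P$2$2 * (t * y) + v$2 = t * Y + w"
      by (simp_all add: X_Y_def u_w_def algebra_simps)
    then have "eval2 (cubic_poly a' b' c' d' e' f' g' h' i' j') (t * x) (t * y)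
      = k * eval2 (cubic_poly a b c d e f g h i j) (t * X + u) (t * Y + w)"
      using assms by (simp only: fun_equiv_by_def)
    moreover have "eval2 (cubic_poly a b c d e f g h i j) (t * X + u) (t * Y + w) = ?F X Y * t^3
      + (3 * a * X^2 * u + b * (X^2 * w + 2 * X * Y * u) + c * (Y^2 * u + 2 * X * Y * w) + 3 * d * Y^2 * w
          + e * X^2 + f * X * Y + g * Y^2) * t^2
      + (3 * a * X * u^2 + b * (Y * u^2 + 2 * X * u * w) + c * (X * w^2 + 2 * Y * u * w) + 3 * d * Y * w^2
          + 2 * e * X * u + f * (X * w + Y * u) + 2 * g * Y * w + h * X + i * Y) * t
      + (a * u^3 + b * u^2 * w + c * u * w^2 + d * w^3 + e * u^2 + f * u * w + g * w^2 + h * u + i * w + j)"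
      (is "_ = _ * t^3 + ?q * t^2 + ?l * t + ?c")
      by (simp add: power2_eq_square power3_eq_cube algebra_simps)
    moreover have "eval2 (cubic_poly a' b' c' d' e' f' g' h' i' j') (t * x) (t * y) = ?G x y * t^3
      + (e' * x^2 + f' * x * y + g' * y^2) * t^2 + (h' * x + i' * y) * t + j'"
      by (simp add: power2_eq_square power3_eq_cube algebra_simps)
    ultimately have "?G x y * t^3 + (e' * x^2 + f' * x * y + g' * y^2) * t^2 + (h' * x + i' * y) * t + j'
      = k * (?F X Y * t^3 + ?q * t^2 + ?l * t + ?c)"
      by (simp only:)
    then show "(?G x y - k * ?F X Y) * t^3 + ((e' * x^2 + f' * x * y + g' * y^2) - k * ?q) * t^2
      + ((h' * x + i' * y) - k * ?l) * t + (j' - k * ?c) = 0"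
      by (rule collect)
  qed
  then show "eval2 (cubic_poly a' b' c' d' 0 0 0 0 0 0) x y = k * eval2 (cubic_poly a b c d 0 0 0 0 0 0)
    (P$1$1 * x + P$1$2 * y + (0 :: real^2)$1) (P$2$1 * x + P$2$2 * y + (0 :: real^2)$2)"
    by (simp add: X_Y_def)
qed (use assms in \<open>auto simp: fun_equiv_by_def\<close>)

text \<open>The three equations are the coefficients of x and of y, each halved, and the constant
  term of the off-diagonal symmetry condition. The first two involve only the cubic part and the
  third only the quadratic part.\<close>

lemma center_cubic_poly:
  "mat2 p q r s \<in> center (cubic_poly a b c d e f g h i j) \<longleftrightarrow>
     3 * a * q + b * (s - p) - c * r = 0 \<and> b * q + c * (s - p) - 3 * d * r = 0
     \<and> 2 * e * q + f * (s - p) - 2 * g * r = 0"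
proof -
  let ?f = "cubic_poly a b c d e f g h i j"
  have H: "hess_at ?f x y = mat2 (6 * a * x + 2 * b * y + 2 * e) (2 * b * x + 2 * c * y + f)
      (2 * b * x + 2 * c * y + f) (2 * c * x + 6 * d * y + 2 * g)" for x y
    by (simp add: hess_at_def cubic_poly_def power2_eq_square power3_eq_cube)
  have "mat2 p q r s \<in> center ?f \<longleftrightarrow> (\<forall>x y.
      (6 * a * x + 2 * b * y + 2 * e) * q + (2 * b * x + 2 * c * y + f) * s =
      (2 * b * x + 2 * c * y + f) * p + (2 * c * x + 6 * d * y + 2 * g) * r)"
    unfolding center_iff_hess_at H mat2_ops mat2_inject by metis
  also have "\<dots> \<longleftrightarrow> (\<forall>x y. 2 * (3 * a * q + b * (s - p) - c * r) * x
      + 2 * (b * q + c * (s - p) - 3 * d * r) * y + (2 * e * q + f * (s - p) - 2 * g * r) = 0)"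
    by (intro all_cong1) (simp add: eq_iff_diff_eq_0[of "_ + _ * s"] algebra_simps)
  also have "\<dots> \<longleftrightarrow> 3 * a * q + b * (s - p) - c * r = 0 \<and> b * q + c * (s - p) - 3 * d * r = 0
     \<and> 2 * e * q + f * (s - p) - 2 * g * r = 0"
  proof -
    have "(\<forall>x y. 2 * A * x + 2 * B * y + C = 0) \<longleftrightarrow> A = 0 \<and> B = 0 \<and> C = 0" for A B C :: real
    proof
      assume *: "\<forall>x y. 2 * A * x + 2 * B * y + C = 0"
      show "A = 0 \<and> B = 0 \<and> C = 0"
        using *[rule_format, of 0 0] *[rule_format, of 1 0] *[rule_format, of 0 1] by simp
    qed simp
    then show ?thesis by blast
  qed
  finally show ?thesis .
qed

section \<open>Normal forms\<close>

lemma mat2_set_eqI: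
  fixes S :: "('a :: zero^2^2) set"
  assumes "\<And>p q r s. mat2 p q r s \<in> S \<longleftrightarrow> mat2 p q r s \<in> S'"
  shows "S = S'"
proof (rule Set.set_eqI)
  fix X show "X \<in> S \<longleftrightarrow> X \<in> S'"
    by (rule mat2_cases[of X]) (simp add: assms)
qed

lemma normal_form_cubic_polys:
  "polyC a * polyX^3 + polyC b * polyX^2 + polyC c * polyX - polyY + polyC d
     = cubic_poly a 0 0 0 b 0 0 c (- 1) d"
  "polyC a * polyX^3 + polyC b * polyX^2 - polyY^2 + polyC c * polyX + polyC d
     = cubic_poly a 0 0 0 b 0 (- 1) c 0 d"
  "polyC a * polyX^3 + polyC b * polyX^2 - polyX * polyY + polyC c * polyX + polyC d
     = cubic_poly a 0 0 0 b (- 1) 0 c 0 d"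
  "- (polyX * polyY^2) + polyC a * polyX^3 + polyC c * polyX - polyC e * polyY + polyC d
     = cubic_poly a 0 (- 1) 0 0 0 0 c (- e) d"
  "- (polyX * polyY^2) + polyC a * polyX^3 + polyC b * polyX^2 + polyC c * polyX - polyC e * polyY + polyC d
     = cubic_poly a 0 (- 1) 0 b 0 0 c (- e) d"
  "- (polyX * polyY^2) + polyC c * polyX - polyC e * polyY + polyC d
     = cubic_poly 0 0 (- 1) 0 0 0 0 c (- e) d"
  "- (polyX * polyY^2) + polyC b * polyX^2 + polyC c * polyX - polyC e * polyY + polyC d
     = cubic_poly 0 0 (- 1) 0 b 0 0 c (- e) d"
  by (rule eval2_eqI; simp)+

text \<open>If the cubic part is ax^3, the first equation of \<open>center_cubic_poly\<close> gives
  q = 0, and then y^2 forces r = 0 while xy forces s = p. If it is ax^3 - xy^2, the first two give r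
  = -3aq and s = p, and an x^2 term forces q = 0. The first and fourth facts, with zero lower
  coefficients, also give the centers of the cubic components.\<close>

lemma normal_form_centers:
  "a \<noteq> 0 \<Longrightarrow> center (cubic_poly a 0 0 0 b 0 0 c e d) = lower_triangular"
  "a \<noteq> 0 \<Longrightarrow> center (cubic_poly a 0 0 0 b 0 (- 1) c 0 d) = diagonal_mats"
  "a \<noteq> 0 \<Longrightarrow> center (cubic_poly a 0 0 0 b (- 1) 0 c 0 d) = dual_mats"
  "center (cubic_poly a 0 (- 1) 0 0 0 0 c e d) = twisted_mats (- 3 * a)"
  "b \<noteq> 0 \<Longrightarrow> center (cubic_poly a 0 (- 1) 0 b 0 0 c e d) = scalar_mats"
  by (rule mat2_set_eqI; auto simp: center_cubic_poly lower_triangular_mat2 diagonal_mats_def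
    dual_mats_def twisted_mats_def scalar_mats_def)+

section \<open>The nine conditions on the pair of centers\<close>

fun center_condition :: "cubic_type \<Rightarrow> (real^2^2) set \<Rightarrow> (real^2^2) set \<Rightarrow> bool" where
  "center_condition Type1 Z Z3 \<longleftrightarrow> Z = Z3 \<and> matrix_algebra Z3 \<cong>\<^sub>A matrix_algebra lower_triangular"
| "center_condition Type2 Z Z3 \<longleftrightarrow> alg_R2 \<cong>\<^sub>A matrix_algebra Z \<and> Z \<subset> Z3
     \<and> matrix_algebra Z3 \<cong>\<^sub>A matrix_algebra lower_triangular"
| "center_condition Type3 Z Z3 \<longleftrightarrow> alg_dual \<cong>\<^sub>A matrix_algebra Z \<and> Z \<subset> Z3
     \<and> matrix_algebra Z3 \<cong>\<^sub>A matrix_algebra lower_triangular"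
| "center_condition Type4 Z Z3 \<longleftrightarrow> Z = Z3 \<and> matrix_algebra Z3 \<cong>\<^sub>A alg_R2"
| "center_condition Type5 Z Z3 \<longleftrightarrow> alg_R \<cong>\<^sub>A matrix_algebra Z \<and> Z \<subset> Z3 \<and> matrix_algebra Z3 \<cong>\<^sub>A alg_R2"
| "center_condition Type6 Z Z3 \<longleftrightarrow> Z = Z3 \<and> matrix_algebra Z3 \<cong>\<^sub>A alg_dual"
| "center_condition Type7 Z Z3 \<longleftrightarrow> alg_R \<cong>\<^sub>A matrix_algebra Z \<and> Z \<subset> Z3 \<and> matrix_algebra Z3 \<cong>\<^sub>A alg_dual"
| "center_condition Type8 Z Z3 \<longleftrightarrow> Z = Z3 \<and> matrix_algebra Z3 \<cong>\<^sub>A alg_C"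
| "center_condition Type9 Z Z3 \<longleftrightarrow> alg_R \<cong>\<^sub>A matrix_algebra Z \<and> Z \<subset> Z3 \<and> matrix_algebra Z3 \<cong>\<^sub>A alg_C"

text \<open>\<open>Z3\<close> falls into one of four classes: T is not commutative, the dual numbers
  have a nilpotent, R^2 has zero divisors but no nilpotent, C has neither. Within a class,
  \<open>Z = Z3\<close> is told apart from proper inclusion, and a nilpotent in \<open>Z\<close>
  separates types 2 and 3.\<close>

lemma center_condition_unique:
  assumes "center_condition k Z Z3" "center_condition k' Z Z3"
  shows "k = k'"
proof -
  have T: "\<not> commutative A" if "A \<cong>\<^sub>A matrix_algebra lower_triangular" for A :: "(real, 'x) module"
    using alg_iso_invariants(1)[OF that] not_commutative_lower_triangular by simp
  have R2: "commutative A" "\<not> has_nilpotent A" "has_zero_divisors A" if "A \<cong>\<^sub>A alg_R2" for A :: "(real, 'x) module"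
    using alg_iso_invariants[OF that] invariants_alg_R2 commutative_type_algebra by auto
  have D: "commutative A" "has_nilpotent A" if "A \<cong>\<^sub>A alg_dual" for A :: "(real, 'x) module"
    using alg_iso_invariants[OF that] invariants_alg_dual by auto
  have C: "commutative A" "\<not> has_nilpotent A" "\<not> has_zero_divisors A" if "A \<cong>\<^sub>A alg_C" for A :: "(real, 'x) module"
    using alg_iso_invariants[OF that] invariants_alg_C commutative_type_algebra by auto
  have R2': "\<not> has_nilpotent A" if "alg_R2 \<cong>\<^sub>A A" for A :: "(real, 'x) module"
    using R2(2)[OF alg_iso_sym[OF that]] .
  have D': "has_nilpotent A" if "alg_dual \<cong>\<^sub>A A" for A :: "(real, 'x) module"
    using D(2)[OF alg_iso_sym[OF that]] .
  show ?thesis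
    using assms by (cases k; cases k'; simp; blast dest: T R2 D C R2' D')
qed

text \<open>One bijection acts on both sets, so equality and proper inclusion survive as well as the
  isomorphism classes.\<close>

lemma center_condition_conj_by:
  assumes P: "invertible P" and Z: "matrix_subalgebra Z" and Z3: "matrix_subalgebra Z3"
    and "center_condition k Z Z3"
  shows "center_condition k (conj_by P ` Z) (conj_by P ` Z3)"
proof -
  have "inj (conj_by P)"
    by (rule injI) (metis conj_by_cancel[OF P] matrix_inv(1)[OF P] matrix_mul_assoc matrix_mul_lid)
  then have ss: "conj_by P ` Z \<subset> conj_by P ` Z3" if "Z \<subset> Z3"
    using that by (auto simp: psubset_eq inj_image_subset_iff inj_image_eq_iff)
  have from_Z: "A \<cong>\<^sub>A matrix_algebra (conj_by P ` Z)" if "A \<cong>\<^sub>A matrix_algebra Z" for A :: "(real, 'x) module"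
    by (rule alg_iso_trans[OF that conj_by_iso[OF Z P]])
  have to_Z3: "matrix_algebra (conj_by P ` Z3) \<cong>\<^sub>A A" if "matrix_algebra Z3 \<cong>\<^sub>A A" for A :: "(real, 'x) module"
    by (rule alg_iso_trans[OF alg_iso_sym[OF conj_by_iso[OF Z3 P]] that])
  show ?thesis
    using assms(4) by (cases k) (simp_all add: from_Z to_Z3 ss)
qed

text \<open>The coefficients are exposed so that the cubic component can be named; the subalgebra
  facts are what conjugation to a general f will need.\<close>

lemma normal_form_center_condition:
  assumes "g \<in> normal_forms k"
  obtains a b c d e f h i j l where "g = cubic_poly a b c d e f h i j l"
    "matrix_subalgebra (center g)" "matrix_subalgebra (center (cubic_poly a b c d 0 0 0 0 0 0))"
    "center_condition k (center g) (center (cubic_poly a b c d 0 0 0 0 0 0))"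
proof -
  have T: "unital_real_algebra (matrix_algebra lower_triangular)"
    by (rule unital_real_algebra_matrix_algebra[OF matrix_subalgebras(1)])
  have TT: "matrix_algebra lower_triangular \<cong>\<^sub>A matrix_algebra lower_triangular"
    by (rule alg_iso_transport[OF T, of id]) auto
  have proper: "diagonal_mats \<subset> lower_triangular" "dual_mats \<subset> lower_triangular" "scalar_mats \<subset> twisted_mats m" for m
  proof -
    have "mat2 0 0 1 0 \<in> lower_triangular - diagonal_mats" "mat2 1 0 0 0 \<in> lower_triangular - dual_mats"
      "mat2 0 1 m 0 \<in> twisted_mats m - scalar_mats"
      by (auto simp: lower_triangular_mat2 diagonal_mats_def dual_mats_def twisted_mats_def scalar_mats_def)
    moreover have "diagonal_mats \<subseteq> lower_triangular" "dual_mats \<subseteq> lower_triangular" "scalar_mats \<subseteq> twisted_mats m"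
      by (auto simp: lower_triangular_mat2 diagonal_mats_def dual_mats_def twisted_mats_def scalar_mats_def)
    ultimately show "diagonal_mats \<subset> lower_triangular" "dual_mats \<subset> lower_triangular" "scalar_mats \<subset> twisted_mats m"
      by blast+
  qed
  have dual: "alg_dual \<cong>\<^sub>A matrix_algebra dual_mats" "matrix_algebra (twisted_mats 0) \<cong>\<^sub>A alg_dual"
    using dual_coset_iso twisted_mats_0_iso_dual_mats alg_iso_sym alg_iso_trans by blast+
  note facts = normal_form_centers matrix_subalgebras T TT proper dual
    alg_R_iso_scalar_mats alg_R2_iso_diagonal_mats twisted_mats_iso_alg_R2 twisted_mats_iso_alg_C
  have "\<exists>a b c d e f h i j l. g = cubic_poly a b c d e f h i j l \<and> matrix_subalgebra (center g)
    \<and> matrix_subalgebra (center (cubic_poly a b c d 0 0 0 0 0 0))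
    \<and> center_condition k (center g) (center (cubic_poly a b c d 0 0 0 0 0 0))"
  proof (cases k)
    case Type1
    obtain a b c d where *: "a \<noteq> 0" "g = cubic_poly a 0 0 0 b 0 0 c (- 1) d"
      using assms unfolding Type1 normal_forms.simps normal_form_cubic_polys by blast
    show ?thesis unfolding Type1 by (intro exI conjI, rule *(2)) (simp_all add: facts *)
  next
    case Type2
    obtain a b c d where *: "a \<noteq> 0" "g = cubic_poly a 0 0 0 b 0 (- 1) c 0 d"
      using assms unfolding Type2 normal_forms.simps normal_form_cubic_polys by blast
    show ?thesis unfolding Type2 by (intro exI conjI, rule *(2)) (simp_all add: facts *)
  next
    case Type3
    obtain a b c d where *: "a \<noteq> 0" "g = cubic_poly a 0 0 0 b (- 1) 0 c 0 d"
      using assms unfolding Type3 normal_forms.simps normal_form_cubic_polys by blast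
    show ?thesis unfolding Type3 by (intro exI conjI, rule *(2)) (simp_all add: facts *)
  next
    case Type4
    obtain a c d e where *: "a < 0" "g = cubic_poly a 0 (- 1) 0 0 0 0 c (- e) d"
      using assms unfolding Type4 normal_forms.simps normal_form_cubic_polys by blast
    show ?thesis unfolding Type4 by (intro exI conjI, rule *(2)) (simp_all add: facts *)
  next
    case Type5
    obtain a b c d e where *: "a < 0" "b \<noteq> 0" "g = cubic_poly a 0 (- 1) 0 b 0 0 c (- e) d"
      using assms unfolding Type5 normal_forms.simps normal_form_cubic_polys by blast
    show ?thesis unfolding Type5 by (intro exI conjI, rule *(3)) (simp_all add: facts *)
  next
    case Type6
    obtain c d e where *: "g = cubic_poly 0 0 (- 1) 0 0 0 0 c (- e) d"
      using assms unfolding Type6 normal_forms.simps normal_form_cubic_polys by blast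
    show ?thesis unfolding Type6 by (intro exI conjI, rule *) (simp_all add: facts *)
  next
    case Type7
    obtain b c d e where *: "b \<noteq> 0" "g = cubic_poly 0 0 (- 1) 0 b 0 0 c (- e) d"
      using assms unfolding Type7 normal_forms.simps normal_form_cubic_polys by blast
    show ?thesis unfolding Type7 by (intro exI conjI, rule *(2)) (simp_all add: facts *)
  next
    case Type8
    obtain a c d e where *: "a > 0" "g = cubic_poly a 0 (- 1) 0 0 0 0 c (- e) d"
      using assms unfolding Type8 normal_forms.simps normal_form_cubic_polys by blast
    show ?thesis unfolding Type8 by (intro exI conjI, rule *(2)) (simp_all add: facts *)
  next
    case Type9
    obtain a b c d e where *: "a > 0" "b \<noteq> 0" "g = cubic_poly a 0 (- 1) 0 b 0 0 c (- e) d"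
      using assms unfolding Type9 normal_forms.simps normal_form_cubic_polys by blast
    show ?thesis unfolding Type9 by (intro exI conjI, rule *(3)) (simp_all add: facts *)
  qed
  then show thesis
    using that by blast
qed

lemma has_type_imp_center_condition:
  assumes "total_degree f \<le> 3" "has_type f k"
  shows "center_condition k (center f) (center (hom_component 3 f))"
proof -
  obtain g P v m where g: "g \<in> normal_forms k" and eq: "fun_equiv_by P v m (eval2 f) (eval2 g)"
    using assms(2) by (auto simp: has_type_def poly_equiv_iff)
  from g obtain a b c d e h i j l n where g': "g = cubic_poly a b c d e h i j l n"
    and sub: "matrix_subalgebra (center g)" "matrix_subalgebra (center (cubic_poly a b c d 0 0 0 0 0 0))"
    and cond: "center_condition k (center g) (center (cubic_poly a b c d 0 0 0 0 0 0))"
    by (rule normal_form_center_condition)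
  obtain a' b' c' d' e' h' i' j' l' n' where f: "f = cubic_poly a' b' c' d' e' h' i' j' l' n'"
    by (rule cubic_polyE[OF assms(1)])
  have "center (hom_component 3 f) = conj_by P ` center (cubic_poly a b c d 0 0 0 0 0 0)"
    using fun_equiv_by_hom_component[OF eq[unfolded f g']]
    unfolding f hom_component_cubic_poly by (rule center_conj_by)
  then show ?thesis
    using center_condition_conj_by[OF fun_equiv_byD(1)[OF eq] sub cond] center_conj_by[OF eq] by simp
qed

section \<open>Reduction of a cubic polynomial to a normal form\<close>

lemma poly_equivI:
  assumes "p * s - q * r \<noteq> 0" "k \<noteq> 0"
    and "\<And>x y. eval2 g x y = k * eval2 f (p * x + q * y + u) (r * x + s * y + w)"
  shows "f \<sim>\<^sub>p g"
proof -
  have "invertible (mat2 p q r s)"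
    using assms(1) by (simp add: invertible_det_nz det_2)
  then have "fun_equiv_by (mat2 p q r s) (vector [u, w]) k (eval2 f) (eval2 g)"
    using assms(2,3) by (simp add: fun_equiv_by_def)
  then show ?thesis
    unfolding poly_equiv_iff by blast
qed

lemma poly_equiv_trans [trans]:
  assumes "f \<sim>\<^sub>p g" "g \<sim>\<^sub>p h"
  shows "f \<sim>\<^sub>p h"
proof -
  obtain P v k P' v' k' where fg: "fun_equiv_by P v k (eval2 f) (eval2 g)" and gh: "fun_equiv_by P' v' k' (eval2 g) (eval2 h)"
    using assms by (auto simp: poly_equiv_iff)
  have "invertible (P ** P')"
    using fg gh by (simp add: fun_equiv_by_def invertible_mult)
  then have "fun_equiv_by (P ** P') (P *v v' + v) (k' * k) (eval2 f) (eval2 h)"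
    using fg gh unfolding fun_equiv_by_def
    by (simp add: fun_equiv_by_def matrix_matrix_mult_def matrix_vector_mult_def sum_2 algebra_simps)
  then show ?thesis
    unfolding poly_equiv_iff by blast
qed

lemma cubic_poly_linear_substitution:
  assumes "p * s - q * r \<noteq> 0" "k \<noteq> 0"
  shows "cubic_poly a b c d e f g h i j \<sim>\<^sub>p cubic_poly
    (k * (a * p^3 + b * p^2 * r + c * p * r^2 + d * r^3))
    (k * (3 * a * p^2 * q + b * (p^2 * s + 2 * p * q * r) + c * (2 * p * r * s + q * r^2) + 3 * d * r^2 * s))
    (k * (3 * a * p * q^2 + b * (2 * p * q * s + q^2 * r) + c * (p * s^2 + 2 * q * r * s) + 3 * d * r * s^2))
    (k * (a * q^3 + b * q^2 * s + c * q * s^2 + d * s^3))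
    (k * (e * p^2 + f * p * r + g * r^2)) (k * (2 * e * p * q + f * (p * s + q * r) + 2 * g * r * s))
    (k * (e * q^2 + f * q * s + g * s^2)) (k * (h * p + i * r)) (k * (h * q + i * s)) (k * j)"
  by (rule poly_equivI[OF assms, where u = 0 and w = 0])
    (simp add: power2_eq_square power3_eq_cube algebra_simps)

lemma real_cubic_root:
  fixes a b c d :: real
  assumes "d \<noteq> 0"
  obtains t where "a + b * t + c * t^2 + d * t^3 = 0"
proof -
  define p where "p = [:a / d, b / d, c / d, 1:]"
  \<comment> \<open>This is -p(-x). It is monic too, so both polynomials are eventually positive,
    and \<open>p\<close> changes sign between \<open>- ?M\<close> and \<open>?M\<close>; the 1 in
    \<open>?M\<close> ensures that this interval is not degenerate.\<close>
  define q where "q = [:- (a / d), b / d, - (c / d), 1:]"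
  obtain m where m: "\<And>x. x \<ge> m \<Longrightarrow> poly p x \<ge> 1"
    using poly_pinfty_gt_lc[of p] by (auto simp: p_def)
  obtain n where n: "\<And>x. x \<ge> n \<Longrightarrow> poly q x \<ge> 1"
    using poly_pinfty_gt_lc[of q] by (auto simp: q_def)
  let ?M = "max 1 (max m n)"
  have "poly p (- x) = - poly q x" for x
    by (simp add: p_def q_def algebra_simps)
  moreover have "poly p ?M \<ge> 1" "poly q ?M \<ge> 1"
    by (auto intro!: m n simp del: max.bounded_iff)
  ultimately have "poly p (- ?M) < 0" "poly p ?M > 0" "- ?M < ?M"
    by simp_all
  then obtain t where "poly p t = 0"
    using poly_IVT_pos by blast
  moreover have "a + b * t + c * t^2 + d * t^3 = d * poly p t"
    using assms by (simp add: p_def field_simps power2_eq_square power3_eq_cube)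
  ultimately show thesis
    using that[of t] by simp
qed

lemma cubic_poly_top_normal_form:
  assumes "a \<noteq> 0 \<or> b \<noteq> 0 \<or> c \<noteq> 0 \<or> d \<noteq> 0"
  obtains a' c' e' f' g' h' i' j' where
    "cubic_poly a b c d e f g h i j \<sim>\<^sub>p cubic_poly a' 0 c' 0 e' f' g' h' i' j'"
    "c' = - 1 \<or> (c' = 0 \<and> a' \<noteq> 0)"
proof -
  have *: "\<exists>a' c' e' f' g' h' i' j'. cubic_poly a b c 0 e f g h i j \<sim>\<^sub>p cubic_poly a' 0 c' 0 e' f' g' h' i' j'
    \<and> (c' = - 1 \<or> (c' = 0 \<and> a' \<noteq> 0))" if nz: "a \<noteq> 0 \<or> b \<noteq> 0 \<or> c \<noteq> 0" for a b c e f g h i j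
  proof -
    consider "c \<noteq> 0" | "c = 0" "b \<noteq> 0" | "c = 0" "b = 0" "a \<noteq> 0"
      using nz by blast
    then show ?thesis
    proof cases
      \<comment> \<open>Replacing y by y - bx/(2c) completes the square and kills x^2 y; the factor
        -1/c normalizes the coefficient of xy^2.\<close>
      case 1
      then show ?thesis
        using cubic_poly_linear_substitution[of 1 1 0 "- b / (2 * c)" "- 1 / c" a b c 0 e f g h i j]
        by (simp add: field_simps) blast
    next
      \<comment> \<open>The form is x^2 (ax + by). The substitution sends the repeated factor x to y
        and the factor ax + by to -x, which gives -xy^2.\<close>
      case 2
      then show ?thesis
        using cubic_poly_linear_substitution[of 0 "- a / b" 1 "- 1 / b" 1 a b 0 0 e f g h i j]
        by (simp add: field_simps power2_eq_square power3_eq_cube) blast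
    next
      case 3
      moreover have "cubic_poly a 0 0 0 e f g h i j \<sim>\<^sub>p cubic_poly a 0 0 0 e f g h i j"
        using cubic_poly_linear_substitution[of 1 1 0 0 1 a 0 0 0 e f g h i j] by simp
      ultimately show ?thesis by blast
    qed
  qed
  show thesis
  proof (cases "d = 0")
    case True
    then show thesis
      using *[of a b c e f g h i j] assms that by auto
  next
    case False
    then obtain t where t: "a + b * t + c * t^2 + d * t^3 = 0"
      by (rule real_cubic_root)
    \<comment> \<open>Substituting \<open>(y, x + t y)\<close> moves the root line to a coordinate axis, which kills the \<open>y\<^sup>3\<close> term.\<close>
    obtain a1 b1 c1 e1 f1 g1 h1 i1 j1 where 1: "cubic_poly a b c d e f g h i j \<sim>\<^sub>p cubic_poly a1 b1 c1 0 e1 f1 g1 h1 i1 j1"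
      and "a1 = d"
      using cubic_poly_linear_substitution[of 0 t 1 1 1 a b c d e f g h i j] t by auto
    \<comment> \<open>The form is still nonzero because \<open>a1 = d\<close>, so the case without
      y^3 applies.\<close>
    then obtain a' c' e' f' g' h' i' j' where
      "cubic_poly a1 b1 c1 0 e1 f1 g1 h1 i1 j1 \<sim>\<^sub>p cubic_poly a' 0 c' 0 e' f' g' h' i' j'"
      "c' = - 1 \<or> (c' = 0 \<and> a' \<noteq> 0)"
      using *[of a1 b1 c1 e1 f1 g1 h1 i1 j1] False by auto
    then show thesis
      using that poly_equiv_trans[OF 1] by blast
  qed
qed

lemma cubic_poly_in_normal_forms:
  "a \<noteq> 0 \<Longrightarrow> cubic_poly a 0 0 0 b 0 0 c (- 1) d \<in> normal_forms Type1"
  "a \<noteq> 0 \<Longrightarrow> cubic_poly a 0 0 0 b 0 (- 1) c 0 d \<in> normal_forms Type2"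
  "a \<noteq> 0 \<Longrightarrow> cubic_poly a 0 0 0 b (- 1) 0 c 0 d \<in> normal_forms Type3"
  "a < 0 \<Longrightarrow> cubic_poly a 0 (- 1) 0 0 0 0 c (- e) d \<in> normal_forms Type4"
  "a < 0 \<Longrightarrow> b \<noteq> 0 \<Longrightarrow> cubic_poly a 0 (- 1) 0 b 0 0 c (- e) d \<in> normal_forms Type5"
  "cubic_poly 0 0 (- 1) 0 0 0 0 c (- e) d \<in> normal_forms Type6"
  "b \<noteq> 0 \<Longrightarrow> cubic_poly 0 0 (- 1) 0 b 0 0 c (- e) d \<in> normal_forms Type7"
  "a > 0 \<Longrightarrow> cubic_poly a 0 (- 1) 0 0 0 0 c (- e) d \<in> normal_forms Type8"
  "a > 0 \<Longrightarrow> b \<noteq> 0 \<Longrightarrow> cubic_poly a 0 (- 1) 0 b 0 0 c (- e) d \<in> normal_forms Type9"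
  unfolding normal_forms.simps normal_form_cubic_polys by blast+

lemma has_type_if_noncube:
  assumes "f \<sim>\<^sub>p cubic_poly a 0 (- 1) 0 e' f' g' h' i' j'"
  obtains k where "has_type f k"
proof -
  note assms
  \<comment> \<open>Expanding -(x + u)(y + w)^2 produces -u y^2 and -2w xy, so u = g' and w = f'/2
    cancel the terms in y^2 and xy. The outer minus sign on the coefficient of y matches the shape
    \<open>- e\<close> of the normal forms.\<close>
  also have "cubic_poly a 0 (- 1) 0 e' f' g' h' i' j' \<sim>\<^sub>p cubic_poly a 0 (- 1) 0 (e' + 3 * a * g') 0 0
      (h' + 2 * e' * g' + 3 * a * g'^2 + f'^2 / 4) (- (- i' - f' * g')) (eval2 (cubic_poly a 0 (- 1) 0 e' f' g' h' i' j') g' (f' / 2))"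
    by (rule poly_equivI[of 1 1 0 0 1 _ _ g' "f' / 2"])
      (simp_all add: power2_eq_square power3_eq_cube field_simps)
  finally obtain b c d e where g: "f \<sim>\<^sub>p cubic_poly a 0 (- 1) 0 b 0 0 c (- e) d"
    by blast
  have "\<exists>k. cubic_poly a 0 (- 1) 0 b 0 0 c (- e) d \<in> normal_forms k"
  proof -
    consider "a < 0" "b = 0" | "a < 0" "b \<noteq> 0" | "a = 0" "b = 0" | "a = 0" "b \<noteq> 0" | "a > 0" "b = 0" | "a > 0" "b \<noteq> 0"
      by linarith
    then show ?thesis
      by cases (use cubic_poly_in_normal_forms(4-9) in metis)+
  qed
  then show thesis
    using that g unfolding has_type_def by blast
qed

text \<open>By the chain rule, \<open>dy g\<close> is a nonzero multiple of the derivative of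
  \<open>f\<close> in the direction of the second column of \<open>P\<close>. That column supplies
  the coefficients and is nonzero because \<open>P\<close> is invertible.\<close>

lemma dependent_partials_if_dy_eq_0:
  assumes "f \<sim>\<^sub>p g" "dy g = 0"
  obtains \<alpha> \<beta> where "polyC \<alpha> * dx f + polyC \<beta> * dy f = 0" "\<not> (\<alpha> = 0 \<and> \<beta> = 0)"
proof -
  obtain P v k where eq: "fun_equiv_by P v k (eval2 f) (eval2 g)"
    using assms(1) by (auto simp: poly_equiv_iff)
  note P = fun_equiv_byD[OF eq]
  have "P$1$2 * eval2 (dx f) a b + P$2$2 * eval2 (dy f) a b = 0" for a b
  proof -
    obtain x y where "P$1$1 * x + P$1$2 * y + v$1 = a" "P$2$1 * x + P$2$2 * y + v$2 = b"
      by (rule affine_map_surj[OF P(1)])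
    moreover have "eval2 (dy g) x y = 0"
      using assms(2) by simp
    ultimately show ?thesis
      using P(2) by (simp add: P(3) chain_rule affine_image_nth eval2_subst2)
  qed
  then have "polyC (P$1$2) * dx f + polyC (P$2$2) * dy f = 0"
    by (intro eval2_eqI) simp
  moreover have "\<not> (P$1$2 = 0 \<and> P$2$2 = 0)"
    using P(1) by (auto simp: invertible_det_nz det_2)
  ultimately show thesis by (rule that)
qed

text \<open>The leading form involves x only, so the strongest lower term in y decides: y^2 gives
  type 2, else xy type 3, else y type 1. If y is absent, \<open>ind\<close> is contradicted.\<close>

lemma has_type_if_cube:
  assumes "f \<sim>\<^sub>p cubic_poly a 0 0 0 e' f' g' h' i' j'" "a \<noteq> 0"
    and ind: "\<And>\<alpha> \<beta> :: real. polyC \<alpha> * dx f + polyC \<beta> * dy f = 0 \<Longrightarrow> \<alpha> = 0 \<and> \<beta> = 0"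
  obtains k where "has_type f k"
proof -
  consider "g' \<noteq> 0" | "g' = 0" "f' \<noteq> 0" | "g' = 0" "f' = 0" "i' \<noteq> 0" | "g' = 0" "f' = 0" "i' = 0"
    by blast
  then show thesis
  proof cases
    case 1
    \<comment> \<open>Completing the square in y removes both xy and y; x itself is left alone, so
      the cubic part remains a multiple of x^3.\<close>
    have "cubic_poly a 0 0 0 e' f' g' h' i' j' \<sim>\<^sub>p cubic_poly (- a / g') 0 0 0 (- (e' - f'^2 / (4 * g')) / g') 0 (- 1)
      (- (h' - f' * i' / (2 * g')) / g') 0 (- (j' - i'^2 / (4 * g')) / g')"
      using 1 by (intro poly_equivI[of 1 1 0 "- f' / (2 * g')" "- 1 / g'" _ _ 0 "- i' / (2 * g')"])
        (simp_all add: power2_eq_square power3_eq_cube field_simps)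
    with assms(1) have "f \<sim>\<^sub>p \<dots>" by (rule poly_equiv_trans)
    moreover have "\<dots> \<in> normal_forms Type2"
      using 1 assms(2) by (intro cubic_poly_in_normal_forms) simp
    ultimately show thesis
      using that unfolding has_type_def by blast
  next
    case 2
    \<comment> \<open>The term f' xy becomes f' xy + f' u y under the shift of x by u, and this u
      cancels i' y.\<close>
    let ?u = "- i' / f'"
    have "cubic_poly a 0 0 0 e' f' g' h' i' j' \<sim>\<^sub>p cubic_poly (- a / f') 0 0 0 (- (e' + 3 * a * ?u) / f') (- 1) 0
      (- (h' + 2 * e' * ?u + 3 * a * ?u^2) / f') 0 (- (a * ?u^3 + e' * ?u^2 + h' * ?u + j') / f')"
      using 2 by (intro poly_equivI[of 1 1 0 0 "- 1 / f'" _ _ ?u 0])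
        (simp_all add: power2_eq_square power3_eq_cube field_simps)
    with assms(1) have "f \<sim>\<^sub>p \<dots>" by (rule poly_equiv_trans)
    moreover have "\<dots> \<in> normal_forms Type3"
      using 2 assms(2) by (intro cubic_poly_in_normal_forms) simp
    ultimately show thesis
      using that unfolding has_type_def by blast
  next
    case 3
    have "cubic_poly a 0 0 0 e' f' g' h' i' j' \<sim>\<^sub>p cubic_poly (- a / i') 0 0 0 (- e' / i') 0 0 (- h' / i') (- 1) (- j' / i')"
      using 3 by (intro poly_equivI[of 1 1 0 0 "- 1 / i'" _ _ 0 0]) (simp_all add: field_simps)
    with assms(1) have "f \<sim>\<^sub>p \<dots>" by (rule poly_equiv_trans)
    moreover have "\<dots> \<in> normal_forms Type1"
      using 3 assms(2) by (intro cubic_poly_in_normal_forms) simp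
    ultimately show thesis
      using that unfolding has_type_def by blast
  next
    case 4
    have "dy (cubic_poly a 0 0 0 e' f' g' h' i' j') = 0"
      unfolding 4 by (rule eval2_eqI) (simp add: cubic_poly_def power2_eq_square power3_eq_cube)
    then obtain \<alpha> \<beta> where "polyC \<alpha> * dx f + polyC \<beta> * dy f = 0" "\<not> (\<alpha> = 0 \<and> \<beta> = 0)"
      by (rule dependent_partials_if_dy_eq_0[OF assms(1)])
    then show thesis using ind by blast
  qed
qed

lemma has_type_exists:
  assumes "total_degree f = 3"
    and ind: "\<And>\<alpha> \<beta> :: real. polyC \<alpha> * dx f + polyC \<beta> * dy f = 0 \<Longrightarrow> \<alpha> = 0 \<and> \<beta> = 0"
  obtains k where "has_type f k"
proof -
  obtain a b c d e k l m n p where f: "f = cubic_poly a b c d e k l m n p"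
    by (rule cubic_polyE[of f]) (use assms(1) in simp)
  have "a \<noteq> 0 \<or> b \<noteq> 0 \<or> c \<noteq> 0 \<or> d \<noteq> 0"
  proof (rule ccontr)
    let ?S = "{i + j | i j. coeff (coeff f j) i \<noteq> 0}"
    assume "\<not> ?thesis"
    then have "?S \<subseteq> {0, 1, 2}"
      by (auto simp: f cubic_poly_monoms coeff_monom split: if_splits)
    then have "insert 0 ?S \<subseteq> {0, 1, 2}" "finite (insert 0 ?S)"
      by (auto dest: finite_subset)
    then have "total_degree f \<in> {0, 1, 2}"
      unfolding total_degree_def by (meson Max_in insert_not_empty subsetD)
    then show False using assms(1) by auto
  qed
  then obtain a' c' e' f' g' h' i' j' where "f \<sim>\<^sub>p cubic_poly a' 0 c' 0 e' f' g' h' i' j'"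
    "c' = - 1 \<or> (c' = 0 \<and> a' \<noteq> 0)"
    unfolding f by (rule cubic_poly_top_normal_form)
  then show thesis
    using has_type_if_noncube has_type_if_cube ind that by metis
qed

theorem theorem3p2:
  fixes f f3 :: "real poly poly"
  assumes "total_degree f = 3"
    and "\<And>\<alpha> \<beta> :: real. polyC \<alpha> * dx f + polyC \<beta> * dy f = 0 \<Longrightarrow> \<alpha> = 0 \<and> \<beta> = 0"
    and "f3 = hom_component 3 f"
  shows "(\<exists>!k. has_type f k)
    \<and> (has_type f Type1 \<longleftrightarrow> center f = center f3
          \<and> matrix_algebra (center f3) \<cong>\<^sub>A matrix_algebra lower_triangular)
    \<and> (has_type f Type2 \<longleftrightarrow> alg_R2 \<cong>\<^sub>A matrix_algebra (center f) \<and> center f \<subset> center f3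
          \<and> matrix_algebra (center f3) \<cong>\<^sub>A matrix_algebra lower_triangular)
    \<and> (has_type f Type3 \<longleftrightarrow> alg_dual \<cong>\<^sub>A matrix_algebra (center f) \<and> center f \<subset> center f3
          \<and> matrix_algebra (center f3) \<cong>\<^sub>A matrix_algebra lower_triangular)
    \<and> (has_type f Type4 \<longleftrightarrow> center f = center f3
          \<and> matrix_algebra (center f3) \<cong>\<^sub>A alg_R2)
    \<and> (has_type f Type5 \<longleftrightarrow> alg_R \<cong>\<^sub>A matrix_algebra (center f) \<and> center f \<subset> center f3
          \<and> matrix_algebra (center f3) \<cong>\<^sub>A alg_R2)
    \<and> (has_type f Type6 \<longleftrightarrow> center f = center f3
          \<and> matrix_algebra (center f3) \<cong>\<^sub>A alg_dual)
    \<and> (has_type f Type7 \<longleftrightarrow> alg_R \<cong>\<^sub>A matrix_algebra (center f) \<and> center f \<subset> center f3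
          \<and> matrix_algebra (center f3) \<cong>\<^sub>A alg_dual)
    \<and> (has_type f Type8 \<longleftrightarrow> center f = center f3
          \<and> matrix_algebra (center f3) \<cong>\<^sub>A alg_C)
    \<and> (has_type f Type9 \<longleftrightarrow> alg_R \<cong>\<^sub>A matrix_algebra (center f) \<and> center f \<subset> center f3
          \<and> matrix_algebra (center f3) \<cong>\<^sub>A alg_C)"
proof -
  have cond: "center_condition k (center f) (center f3)" if "has_type f k" for k
    using has_type_imp_center_condition that assms(1,3) by simp
  obtain k0 where k0: "has_type f k0"
    by (rule has_type_exists[OF assms(1,2)])
  \<comment> \<open>For the converse, the condition for \<open>k\<close> holds next to the one for
    the actual type \<open>k0\<close>, so uniqueness identifies them.\<close>
  have type: "has_type f k \<longleftrightarrow> center_condition k (center f) (center f3)" for k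
    using center_condition_unique[OF cond[OF k0]] cond k0 by metis
  have "\<exists>!k. has_type f k"
    using center_condition_unique cond k0 by blast
  then show ?thesis
    unfolding type center_condition.simps by (intro conjI refl)
qed

end
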